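(* Let $D\in\mathbb{N}$ and let $\Xi_{\mathsf{H}_D}$ be the Heisenberg determinantal point process on $\mathbb{C}^D$ (defined in the context). For $R>0$ let $\mathbb{B}^{(2D)}_R=\{x\in\mathbb{C}^D:|x|<R\}$. Then $\Xi_{\mathsf{H}_D}$ is hyperuniform of Class I, i.e. $\mathrm{Var}[\Xi_{\mathsf{H}_D}(\mathbb{B}^{(2D)}_R)] \asymp R^{2D-1}$ as $R\to\infty$ (there exist constants $0<c_1<c_2<\infty$ with $c_1R^{2D-1}<\mathrm{Var}[\Xi_{\mathsf{H}_D}(\mathbb{B}^{(2D)}_R)]<c_2R^{2D-1}$ for all large $R$), and more precisely \[ \lim_{R\to\infty} R\,\frac{\mathrm{Var}[\Xi_{\mathsf{H}_D}(\mathbb{B}^{(2D)}_R)]}{\mathbb{E}[\Xi_{\mathsf{H}_D}(\mathbb{B}^{(2D)}_R)]}=\frac{D}{\sqrt{\pi}}. \] Moreover, the following asymptotic expansion holds as $R\to\infty$: \[ \frac{\mathrm{Var}[\Xi_{\mathsf{H}_D}(\mathbb{B}^{(2D)}_R)]}{\mathbb{E}[\Xi_{\mathsf{H}_D}(\mathbb{B}^{(2D)}_R)]} \sim \frac{D}{\sqrt{\pi}} R^{-1}\sum_{k=0}^{\infty}(-1)^k\frac{\alpha_k(D)}{(2k+1)\,k!\,2^{4k}}R^{-2k}, \] where $\alpha_0(D)=1$ and $\alpha_k(D)=\prod_{\ell=1}^k\{4D^2-(2\ell-1)^2\}=\prod_{\ell=-k+1}^{k}(2D+2\ell-1)$ for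 $k\in\mathbb{N}$.
   Context: For $x, y \in \mathbb{C}^D$, $x\cdot\overline{y}=\sum_{\ell=1}^D x^{(\ell)}\overline{y^{(\ell)}}$ and $|x|=\sqrt{x\cdot\overline{x}}$. A simple point process $\Xi$ on $S$ with reference measure $\lambda$ is a determinantal point process (DPP) with correlation kernel $K$ if for every $n$ its $n$-th correlation function with respect to $\lambda^{\otimes n}$ is $\det_{1\le i,j\le n}[K(x_i,x_j)]$. The Heisenberg DPP $\Xi_{\mathsf{H}_D}$ is the DPP on $\mathbb{C}^D$ with kernel $K_{\mathsf{H}_D}(x,y)=e^{x\cdot\overline{y}}$ with respect to $\lambda(dx)=\pi^{-D}e^{-|x|^2}dx$ ($dx$ Lebesgue measure on $\mathbb{C}^D\simeq\mathbb{R}^{2D}$). $\Xi(\Lambda)$ denotes the number of points in $\Lambda$. The asymptotic expansion $f(R)\sim R^{-1}\sum_k a_kR^{-2k}$ is meant in the Poincaré sense: for each $N$, $f(R)-R^{-1}\sum_{k=0}^{N}a_kR^{-2k}=O(R^{-2N-3})$. *)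

theory Defs
  imports "HOL-Probability.Probability" "HOL-Library.Landau_Symbols"
begin

text \<open>Points of C^D are vectors of type complex ^ 'd, with D = CARD('d).
  The norm on complex ^ 'd is the Euclidean norm |x| = sqrt(x . conj x).
  lborel on complex ^ 'd is Lebesgue measure on R^(2D).\<close>

definition cdot :: "complex ^ 'd \<Rightarrow> complex ^ 'd \<Rightarrow> complex" where
  "cdot x y = (\<Sum>l\<in>UNIV. x $ l * cnj (y $ l))"

definition heis_kernel :: "complex ^ 'd \<Rightarrow> complex ^ 'd \<Rightarrow> complex" where
  "heis_kernel x y = exp (cdot x y)"

definition heis_ref :: "(complex ^ 'd) measure" where
  "heis_ref = density lborel
     (\<lambda>x. ennreal (pi powr (- real CARD('d)) * exp (- (norm x)\<^sup>2)))"

definition det_n :: "nat \<Rightarrow> (nat \<Rightarrow> nat \<Rightarrow> complex) \<Rightarrow> complex" where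
  "det_n n A = (\<Sum>p\<in>{p. p permutes {..<n}}. of_int (sign p) * (\<Prod>i<n. A i (p i)))"

text \<open>A simple point process on a Euclidean space, given as a random locally finite
  set Xi on a probability space M, is a DPP with kernel K w.r.t. reference measure lam
  if for every n \<ge> 1 its n-th correlation function w.r.t. lam^n is det[K(x_i,x_j)], i.e.
  E[sum over pairwise distinct n-tuples of points of f] = integral of f * det[K] d lam^n
  for every nonnegative Borel f.\<close>
definition is_DPP ::
  "'w measure \<Rightarrow> ('w \<Rightarrow> 'a::euclidean_space set) \<Rightarrow> 'a measure
   \<Rightarrow> ('a \<Rightarrow> 'a \<Rightarrow> complex) \<Rightarrow> bool" where
  "is_DPP M Xi lam K \<longleftrightarrow>
     prob_space M \<and>
     (\<forall>\<omega>\<in>space M. \<forall>B. bounded B \<longrightarrow> finite (Xi \<omega> \<inter> B)) \<and>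
     (\<forall>B\<in>sets borel. bounded B \<longrightarrow>
        (\<lambda>\<omega>. real (card (Xi \<omega> \<inter> B))) \<in> borel_measurable M) \<and>
     (\<forall>n\<ge>1. \<forall>f \<in> borel_measurable (PiM {..<n} (\<lambda>_. borel)).
        (\<integral>\<^sup>+\<omega>. (\<integral>\<^sup>+g. f g \<partial>count_space
              {g \<in> {..<n} \<rightarrow>\<^sub>E Xi \<omega>. inj_on g {..<n}}) \<partial>M)
        = (\<integral>\<^sup>+x. f x * ennreal (Re (det_n n (\<lambda>i j. K (x i) (x j))))
              \<partial>PiM {..<n} (\<lambda>_. lam)))"

definition alpha_coef :: "nat \<Rightarrow> nat \<Rightarrow> real" where
  "alpha_coef k D = (\<Prod>l=1..k. 4 * (real D)\<^sup>2 - (2 * real l - 1)\<^sup>2)"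

end

theory Submission
  imports Defs
begin

text \<open>
  The first two correlation functions give, for \<open>B = ball 0 R\<close> and \<open>n = 2 * D\<close>,
  \<open>Var = pi ^ (- n) * (\<integral>x\<in>B. \<integral>y\<notin>B. exp (- |x - y|\<^sup>2))\<close>. Substituting \<open>y = x + z\<close>, the variance is a
  Gaussian average of the volumes of \<open>{x \<in> B. x + z \<notin> B}\<close>. A translation shows that this set has the volume
  of the slab \<open>{x \<in> B. |x \<bullet> z| \<le> |z|\<^sup>2 / 2}\<close>, so \<open>Var / E\<close> is the Gaussian average of \<open>H (|z| / (2 * R))\<close>, where
  \<open>H s\<close> is proportional to the integral of \<open>(1 - t\<^sup>2) powr (D - 1/2)\<close> over \<open>|t| \<le> min s 1\<close>. The binomial series,
  with a remainder bounded by a power of \<open>s\<close> for every \<open>s \<ge> 0\<close>, then reduces the expansion to the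
  odd absolute moments of the Gaussian.
\<close>

section \<open>Invariance of Lebesgue measure and slabs of balls\<close>

text \<open>The kernel is not translation invariant, but \<open>K x y * K y x\<close> weighted by
  both reference densities is pi^(-2D) exp(-|x - y|^2), and this Gaussian has total mass exactly
  pi^D. The mean, which is the diagonal term of the variance, is therefore itself a double integral
  over the ball times the whole space. Removing the part over the ball times the ball leaves only
  pairs separated by the sphere, so the volume order R^(2D) cancels. The exponent D - 1/2 is half an
  odd number, so the binomial series never terminates. Its coefficients get multiplied by Gaussian
  moments proportional to Gamma(D + k + 1/2), and the resulting series in 1/R diverges; hence every
  estimate is made for a fixed truncation order \<open>N\<close>. In \<open>alpha_coef\<close> each
  factor pairs 2D - (2l - 1), from the binomial coefficient, with 2D + (2l - 1), from the moment. Of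
  the 2^(4k) in the denominator, one 4^k comes from |z| / 2 and the other from clearing the halves
  in these two factors.\<close>

lemma nn_integral_lborel_shift:
  fixes f :: "'a::euclidean_space \<Rightarrow> ennreal"
  assumes [measurable]: "f \<in> borel_measurable borel"
  shows "(\<integral>\<^sup>+x. f (a + x) \<partial>lborel) = (\<integral>\<^sup>+x. f x \<partial>lborel)"
proof -
  have "(\<integral>\<^sup>+x. f x \<partial>lborel) = (\<integral>\<^sup>+x. f x \<partial>distr lborel borel ((+) a))"
    by (subst lborel_distr_plus) simp
  also have "\<dots> = (\<integral>\<^sup>+x. f (a + x) \<partial>lborel)"
    by (subst nn_integral_distr) auto
  finally show ?thesis by simp
qed

text \<open>Multiply by the volume of the unit ball and compare the two sides of the double integral of
  \<open>g y * f (T x + y)\<close>, with \<open>g\<close> the indicator of the ball.\<close>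
lemma nn_integral_lborel_linear_involution:
  fixes f :: "'a::euclidean_space \<Rightarrow> ennreal" and T :: "'a \<Rightarrow> 'a"
  assumes [measurable]: "f \<in> borel_measurable borel"
    and T: "linear T" "\<And>x. T (T x) = x" "\<And>x. norm (T x) = norm x"
  shows "(\<integral>\<^sup>+x. f (T x) \<partial>lborel) = (\<integral>\<^sup>+x. f x \<partial>lborel)"
proof -
  define g :: "'a \<Rightarrow> ennreal" where "g = indicator (ball 0 1)"
  define c where "c = (\<integral>\<^sup>+x. g x \<partial>lborel)"
  have [measurable]: "g \<in> borel_measurable borel" unfolding g_def by (intro borel_measurable_indicator) simp
  have [measurable]: "T \<in> borel_measurable borel"
    using T(1) by (intro borel_measurable_continuous_onI linear_continuous_on) (simp add: linear_conv_bounded_linear)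
  have c: "c = ennreal (unit_ball_vol (DIM('a)))"
    by (simp add: c_def g_def emeasure_ball)
  have "c * (\<integral>\<^sup>+x. f (T x) \<partial>lborel) = (\<integral>\<^sup>+y. g y * (\<integral>\<^sup>+x. f (T x) \<partial>lborel) \<partial>lborel)"
    by (simp add: c_def nn_integral_multc)
  also have "\<dots> = (\<integral>\<^sup>+y. g y * (\<integral>\<^sup>+x. f (T (T y + x)) \<partial>lborel) \<partial>lborel)"
    by (subst nn_integral_lborel_shift[of "\<lambda>x. f (T x)"]) auto
  also have "\<dots> = (\<integral>\<^sup>+y. (\<integral>\<^sup>+x. g y * f (T x + y) \<partial>lborel) \<partial>lborel)"
    by (simp add: nn_integral_cmult linear_add[OF T(1)] T(2) add.commute)
  also have "\<dots> = (\<integral>\<^sup>+x. (\<integral>\<^sup>+y. g y * f (T x + y) \<partial>lborel) \<partial>lborel)"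
    by (intro lborel_pair.Fubini') simp
  also have "\<dots> = (\<integral>\<^sup>+x. (\<integral>\<^sup>+y. g (- T x + y) * f y \<partial>lborel) \<partial>lborel)"
  proof (rule nn_integral_cong)
    fix x
    show "(\<integral>\<^sup>+y. g y * f (T x + y) \<partial>lborel) = (\<integral>\<^sup>+y. g (- T x + y) * f y \<partial>lborel)"
      using nn_integral_lborel_shift[of "\<lambda>y. g y * f (T x + y)" "- T x"] by simp
  qed
  also have "\<dots> = (\<integral>\<^sup>+y. (\<integral>\<^sup>+x. g (- T x + y) * f y \<partial>lborel) \<partial>lborel)"
    by (intro lborel_pair.Fubini') simp
  also have "\<dots> = (\<integral>\<^sup>+y. (\<integral>\<^sup>+x. g (- T y + x) * f y \<partial>lborel) \<partial>lborel)"
  proof (intro nn_integral_cong)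
    fix x y
    \<comment> \<open>The isometry enters here: the ball is invariant under \<open>T\<close> and
      under negation, so the roles of \<open>x\<close> and \<open>y\<close> in \<open>g\<close> can
      be exchanged. Afterwards \<open>f\<close> no longer depends on the inner variable.\<close>
    have "norm (- T x + y) = norm (T (- T x + y))" by (simp add: T)
    also have "T (- T x + y) = -(- T y + x)"
      by (simp add: linear_diff[OF T(1)] T(2))
    finally show "g (- T x + y) * f y = g (- T y + x) * f y"
      by (simp add: g_def indicator_def norm_minus_commute)
  qed
  also have "\<dots> = (\<integral>\<^sup>+y. c * f y \<partial>lborel)"
  proof (rule nn_integral_cong)
    fix y
    show "(\<integral>\<^sup>+x. g (- T y + x) * f y \<partial>lborel) = c * f y"
      using nn_integral_lborel_shift[of g "- T y"] by (subst nn_integral_multc) (auto simp: c_def)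
  qed
  also have "\<dots> = c * (\<integral>\<^sup>+y. f y \<partial>lborel)"
    by (simp add: nn_integral_cmult)
  finally show ?thesis
    using unit_ball_vol_pos[of "DIM('a)"] by (auto simp: c ennreal_mult_cancel_left simp del: unit_ball_vol_pos)
qed

text \<open>Reflection in the hyperplane orthogonal to w = a - b. Equal norms give 2 (a . w) = w .
  w, so exactly one copy of \<open>w\<close> is subtracted from \<open>a\<close>. For a = b there is
  no such hyperplane and the identity serves.\<close>

lemma exists_isometric_involution:
  fixes a b :: "'a::euclidean_space"
  assumes ab: "norm a = norm b"
  obtains T where "linear T" "\<And>x. T (T x) = x" "\<And>x y. T x \<bullet> T y = x \<bullet> y" "T a = b"
proof (cases "a = b")
  case True
  show ?thesis by (rule that[of id]) (use True in \<open>auto intro: linear_id\<close>)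
next
  case False
  define w where "w = a - b"
  have ww: "w \<bullet> w \<noteq> 0" using False by (simp add: w_def)
  define T where "T = (\<lambda>x. x - (2 * (x \<bullet> w) / (w \<bullet> w)) *\<^sub>R w)"
  have lin: "linear T"
    by (rule linearI) (auto simp: T_def inner_add_left algebra_simps add_divide_distrib)
  have inv: "T (T x) = x" for x
    using ww by (simp add: T_def inner_diff_left field_simps)
  have inn: "T x \<bullet> T y = x \<bullet> y" for x y
    using ww by (simp add: T_def inner_diff_left inner_diff_right field_simps inner_commute)
  have "2 * (a \<bullet> w) = w \<bullet> w"
    using ab by (simp add: w_def inner_diff_left inner_diff_right inner_commute norm_eq)
  then have "T a = b" using ww by (simp add: T_def w_def)
  with lin inv inn show ?thesis by (intro that[of T]) auto
qed

text \<open>In dimension 1 the right-hand side would be wrong for \<open>|t| > R\<close>, since \<open>0 ^ 0 = 1\<close>.\<close>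
lemma emeasure_ball_slab_Basis:
  fixes e :: "'a::euclidean_space"
  assumes e: "e \<in> Basis" and R: "R > 0" and dim: "DIM('a) \<ge> 2"
  shows "emeasure lborel {x::'a. norm x < R \<and> -s < x \<bullet> e \<and> x \<bullet> e \<le> s}
       = (\<integral>\<^sup>+t. ennreal (unit_ball_vol (DIM('a) - 1) * sqrt (max 0 (R\<^sup>2 - t\<^sup>2)) ^ (DIM('a) - 1))
              * indicator {-s<..s} t \<partial>lborel)"
proof -
  interpret product_sigma_finite "\<lambda>_. lborel"
    by standard
  let ?A = "Basis - {e}"
  have ins: "Basis = insert e ?A" using e by auto
  have fin: "finite ?A" and ne: "e \<notin> ?A" by auto
  have card: "card ?A = DIM('a) - 1" using e by simp

  let ?P = "PiM Basis (\<lambda>_::'a. lborel :: real measure)"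
  let ?N = "\<lambda>B f. sqrt (\<Sum>i\<in>B. (f i)\<^sup>2) :: real"
  let ?X = "{f :: 'a \<Rightarrow> real. ?N Basis f \<le> R \<and> f e \<in> {-s<..s}}"
  \<comment> \<open>The product-measure formula for ball volumes concerns closed balls, so the open
    ball is first enlarged by its null boundary.\<close>
  have sph: "sphere 0 R \<in> null_sets (lborel :: 'a measure)"
    by (auto simp: null_sets_completion_iff negligible_iff_null_sets[symmetric] negligible_sphere
        intro: negligible_sphere[unfolded negligible_iff_null_sets, THEN null_sets_completion_iff[THEN iffD1, rotated]])
  have slice: "emeasure (PiM ?A (\<lambda>_. lborel)) ({f. ?N ?A f \<le> sqrt (R\<^sup>2 - t\<^sup>2)} \<inter> space (PiM ?A (\<lambda>_. lborel)))
      = ennreal (unit_ball_vol (DIM('a) - 1) * sqrt (R\<^sup>2 - t\<^sup>2) ^ (DIM('a) - 1))" if "t\<^sup>2 < R\<^sup>2" for t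
    using emeasure_cball_aux[OF fin, of "sqrt (R\<^sup>2 - t\<^sup>2)"] that card by simp
  have meas [measurable]: "{f. ?N ?A f \<le> a} \<inter> space (PiM ?A (\<lambda>_. lborel)) \<in> sets (PiM ?A (\<lambda>_. lborel))" for a
    by measurable
  have measB [measurable]: "?X \<inter> space ?P \<in> sets ?P"
    using e by measurable
  have X: "(\<lambda>f. \<Sum>b\<in>Basis. f b *\<^sub>R b) -` {x::'a. norm x \<le> R \<and> -s < x \<bullet> e \<and> x \<bullet> e \<le> s} = ?X"
  proof -
    have "norm (\<Sum>b\<in>Basis. f b *\<^sub>R b :: 'a) = ?N Basis f" for f
      using euclidean_dist_l2[of 0 "\<Sum>b\<in>Basis. f b *\<^sub>R b :: 'a"] by (simp add: L2_set_def)
    then show ?thesis using e by auto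
  qed
  have "emeasure lborel {x::'a. norm x < R \<and> -s < x \<bullet> e \<and> x \<bullet> e \<le> s}
      = emeasure lborel {x::'a. norm x \<le> R \<and> -s < x \<bullet> e \<and> x \<bullet> e \<le> s}"
    by (rule emeasure_eq_AE, rule AE_mp[OF AE_not_in[OF sph]]) auto
  also have "\<dots> = emeasure ?P (?X \<inter> space ?P)"
    by (subst lborel_eq, subst emeasure_distr) (measurable, simp only: X)
  also have "\<dots> = (\<integral>\<^sup>+f. indicator (?X \<inter> space ?P) f \<partial>?P)"
    using measB by simp
  also have "\<dots> = (\<integral>\<^sup>+t. \<integral>\<^sup>+f. indicator (?X \<inter> space ?P) (f(e := t)) \<partial>PiM ?A (\<lambda>_. lborel) \<partial>lborel)"
    using measB by (subst ins, subst product_nn_integral_insert_rev[OF fin ne]) (auto simp: insert_absorb[OF e])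
  also have "\<dots> = (\<integral>\<^sup>+t. ennreal (unit_ball_vol (DIM('a) - 1) * sqrt (max 0 (R\<^sup>2 - t\<^sup>2)) ^ (DIM('a) - 1))
              * indicator {-s<..s} t \<partial>lborel)"
  proof (intro nn_integral_cong_AE)
    \<comment> \<open>\<open>slice\<close> needs a positive radius and the empty slices need
      \<open>R\<^sup>2 < t\<^sup>2\<close>; the two heights in between are discarded as a null
      set.\<close>
    have "AE t in lborel. t \<notin> {-R, R}"
      by (intro AE_not_in countable_imp_null_set_lborel) auto
    then show "AE t in lborel. (\<integral>\<^sup>+f. indicator (?X \<inter> space ?P) (f(e := t)) \<partial>PiM ?A (\<lambda>_. lborel))
       = ennreal (unit_ball_vol (DIM('a) - 1) * sqrt (max 0 (R\<^sup>2 - t\<^sup>2)) ^ (DIM('a) - 1))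
              * indicator {-s<..s} t"
    proof eventually_elim
      case (elim t)
      have N: "?N Basis (f(e := t)) \<le> R \<longleftrightarrow> t\<^sup>2 + (\<Sum>i\<in>?A. (f i)\<^sup>2) \<le> R\<^sup>2" for f
      proof -
        have "(\<Sum>i\<in>Basis. ((f(e := t)) i)\<^sup>2) = t\<^sup>2 + (\<Sum>i\<in>?A. ((f(e := t)) i)\<^sup>2)"
          by (subst ins, subst sum.insert) auto
        also have "(\<Sum>i\<in>?A. ((f(e := t)) i)\<^sup>2) = (\<Sum>i\<in>?A. (f i)\<^sup>2)"
          by (intro sum.cong) auto
        finally show ?thesis using R by (simp add: real_sqrt_le_iff' sum_nonneg)
      qed
      have sp: "f(e := t) \<in> space ?P" if "f \<in> space (PiM ?A (\<lambda>_. lborel))" for f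
        using that e by (auto simp: space_PiM PiE_def extensional_def)
      show ?case
      proof (cases "t\<^sup>2 < R\<^sup>2")
        case True
        have "(\<integral>\<^sup>+f. indicator (?X \<inter> space ?P) (f(e := t)) \<partial>PiM ?A (\<lambda>_. lborel))
            = (\<integral>\<^sup>+f. indicator {-s<..s} t * indicator ({f. ?N ?A f \<le> sqrt (R\<^sup>2 - t\<^sup>2)} \<inter> space (PiM ?A (\<lambda>_. lborel))) f
                 \<partial>PiM ?A (\<lambda>_. lborel))"
        proof (intro nn_integral_cong)
          fix f assume f: "f \<in> space (PiM ?A (\<lambda>_. lborel :: real measure))"
          show "indicator (?X \<inter> space ?P) (f(e := t)) = 
             (indicator {-s<..s} t * indicator ({f. ?N ?A f \<le> sqrt (R\<^sup>2 - t\<^sup>2)} \<inter> space (PiM ?A (\<lambda>_. lborel))) f :: ennreal)"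
            using N[of f] sp[OF f] f True by (auto simp: indicator_def)
        qed
        also have "\<dots> = indicator {-s<..s} t * ennreal (unit_ball_vol (DIM('a) - 1) * sqrt (R\<^sup>2 - t\<^sup>2) ^ (DIM('a) - 1))"
          by (subst nn_integral_cmult) (measurable, simp only: nn_integral_indicator[OF meas] slice[OF True])
        finally show ?thesis using True by (simp add: mult.commute)
      next
        case False
        then have gt: "R\<^sup>2 < t\<^sup>2"
          using elim power2_eq_iff[of t R] by auto
        have "t\<^sup>2 + (\<Sum>i\<in>?A. (f i)\<^sup>2) > R\<^sup>2" for f
          using gt sum_nonneg[of ?A "\<lambda>i. (f i)\<^sup>2"] by (simp add: add_strict_increasing)
        then have "indicator (?X \<inter> space ?P) (f(e := t)) = (0::ennreal)" for f
          using N[of f] by (auto simp: indicator_def not_le[symmetric])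
        then have L: "(\<integral>\<^sup>+f. indicator (?X \<inter> space ?P) (f(e := t)) \<partial>PiM ?A (\<lambda>_. lborel)) = 0"
          by simp
        show ?thesis
          using L gt dim by (simp add: max_def)
      qed
    qed
  qed
  finally show ?thesis .
qed

text \<open>Volume of the slice of the unit ball of R^n at height \<open>t\<close>, relative to the
  unit ball of dimension n - 1. The clamp makes the profile vanish for |t| > 1 when n is at least 2,
  so that slabs of any width are covered by one formula.\<close>

definition ball_profile :: "nat \<Rightarrow> real \<Rightarrow> real" where
  "ball_profile n t = sqrt (max 0 (1 - t\<^sup>2)) ^ (n - 1)"

text \<open>Share of the unit ball of R^n lying in the central slab of half-width \<open>s\<close>.
  For positive \<open>n\<close> and \<open>s\<close> in [0, 1] it is the regularised incomplete beta
  function with parameters 1/2 and (n + 1)/2 at s^2.\<close>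

definition slab_fraction :: "nat \<Rightarrow> real \<Rightarrow> real" where
  "slab_fraction n s = unit_ball_vol (real (n - 1)) / unit_ball_vol n * integral {-s..s} (ball_profile n)"

lemma continuous_on_ball_profile [continuous_intros]: "continuous_on A (ball_profile n)"
  unfolding ball_profile_def by (intro continuous_intros)

lemma ball_profile_nonneg: "ball_profile n t \<ge> 0"
  by (simp add: ball_profile_def)

lemma slab_fraction_nonneg: "n > 0 \<Longrightarrow> slab_fraction n s \<ge> 0"
  unfolding slab_fraction_def
  by (intro mult_nonneg_nonneg divide_nonneg_nonneg integral_nonneg integrable_continuous_interval
      continuous_on_ball_profile) (auto simp: ball_profile_nonneg)

text \<open>A reflection taking \<open>u\<close> to a basis vector reduces to a coordinate slab, and
  t = R t' scales it to the unit ball. The slab is half-open so that it fits the exact partition of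
  the ball used for the shifted ball; its missing face is a null set.\<close>

lemma emeasure_ball_slab:
  fixes u :: "'a::euclidean_space"
  assumes u: "norm u = 1" and R: "R > 0" and s: "s \<ge> 0" and dim: "DIM('a) \<ge> 2"
  shows "emeasure lborel {x::'a. norm x < R \<and> -s < x \<bullet> u \<and> x \<bullet> u \<le> s}
       = ennreal (unit_ball_vol DIM('a) * R ^ DIM('a) * slab_fraction DIM('a) (s / R))"
proof -
  let ?n = "DIM('a)"
  obtain e :: 'a where e: "e \<in> Basis" using nonempty_Basis by blast
  have "norm u = norm e" using u e by simp
  then obtain T where T: "linear T" "\<And>x. T (T x) = x" "\<And>x y. T x \<bullet> T y = x \<bullet> y" "T u = e"
    by (rule exists_isometric_involution) blast
  have nT: "norm (T x) = norm x" for x by (simp add: norm_eq_sqrt_inner T)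
  have Te: "T x \<bullet> e = x \<bullet> u" for x using T(3)[of x u] T(4) by simp
  let ?S = "\<lambda>v. {x::'a. norm x < R \<and> -s < x \<bullet> v \<and> x \<bullet> v \<le> s}"
  have "emeasure lborel (?S u) = (\<integral>\<^sup>+x. indicator (?S u) x \<partial>lborel)"
    by simp
  also have "\<dots> = (\<integral>\<^sup>+x. indicator (?S e) (T x) \<partial>lborel)"
    by (intro nn_integral_cong) (simp add: indicator_def nT Te)
  also have "\<dots> = (\<integral>\<^sup>+x. indicator (?S e) x \<partial>lborel)"
    by (rule nn_integral_lborel_linear_involution) (auto simp: T nT)
  also have "\<dots> = emeasure lborel (?S e)" by simp
  also have "\<dots> = (\<integral>\<^sup>+t. ennreal (unit_ball_vol (?n - 1) * sqrt (max 0 (R\<^sup>2 - t\<^sup>2)) ^ (?n - 1))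
              * indicator {-s<..s} t \<partial>lborel)"
    by (rule emeasure_ball_slab_Basis[OF e R dim])
  also have "\<dots> = ennreal \<bar>R\<bar> * (\<integral>\<^sup>+t. ennreal (unit_ball_vol (?n - 1) * sqrt (max 0 (R\<^sup>2 - (0 + R * t)\<^sup>2)) ^ (?n - 1))
              * indicator {-s<..s} (0 + R * t) \<partial>lborel)"
    using R by (intro nn_integral_real_affine) auto
  also have "\<dots> = (\<integral>\<^sup>+t. ennreal R * (ennreal (unit_ball_vol (?n - 1) * sqrt (max 0 (R\<^sup>2 - (0 + R * t)\<^sup>2)) ^ (?n - 1))
              * indicator {-s<..s} (0 + R * t)) \<partial>lborel)"
    using R by (subst nn_integral_cmult) auto
  also have "\<dots> = (\<integral>\<^sup>+t. ennreal ((unit_ball_vol (?n - 1) * R ^ ?n) * ball_profile ?n t)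
              * indicator {-(s/R)..s/R} t \<partial>lborel)"
  proof (intro nn_integral_cong_AE)
    have "AE t in lborel. t \<notin> {-(s/R)}" by (intro AE_not_in countable_imp_null_set_lborel) auto
    then show "AE t in lborel. ennreal R * (ennreal (unit_ball_vol (?n - 1) * sqrt (max 0 (R\<^sup>2 - (0 + R * t)\<^sup>2)) ^ (?n - 1))
              * indicator {-s<..s} (0 + R * t)) = ennreal ((unit_ball_vol (?n - 1) * R ^ ?n) * ball_profile ?n t)
              * indicator {-(s/R)..s/R} t"
    proof eventually_elim
      case t: (elim t)
      have ind: "indicator {-s<..s} (0 + R * t) = (indicator {-(s/R)..s/R} t :: ennreal)"
        using R t by (auto simp: indicator_def field_simps)
      have "max 0 (R\<^sup>2 - (0 + R * t)\<^sup>2) = R\<^sup>2 * max 0 (1 - t\<^sup>2)"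
        using R by (simp add: max_mult_distrib_left algebra_simps power2_eq_square)
      then have "R * (unit_ball_vol (?n - 1) * sqrt (max 0 (R\<^sup>2 - (0 + R * t)\<^sup>2)) ^ (?n - 1))
          = unit_ball_vol (?n - 1) * (R * R ^ (?n - 1)) * ball_profile ?n t"
        using R by (simp add: real_sqrt_mult power_mult_distrib ball_profile_def)
      also have "R * R ^ (?n - 1) = R ^ ?n"
        by (simp flip: power_Suc)
      finally show ?case
        using R by (simp only: ind mult.assoc[symmetric] ennreal_mult'[symmetric] less_imp_le)
    qed
  qed
  also have "\<dots> = ennreal (integral {-(s/R)..s/R} (\<lambda>t. (unit_ball_vol (?n - 1) * R ^ ?n) * ball_profile ?n t))"
    using R dim by (intro nn_integral_has_integral_lebesgue' integrable_integral
       integrable_continuous_interval continuous_intros mult_nonneg_nonneg ball_profile_nonneg) auto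
  also have "integral {-(s/R)..s/R} (\<lambda>t. (unit_ball_vol (?n - 1) * R ^ ?n) * ball_profile ?n t)
     = unit_ball_vol ?n * R ^ ?n * slab_fraction ?n (s / R)"
    using unit_ball_vol_pos[of ?n] dim
    by (auto simp: slab_fraction_def of_nat_diff simp del: unit_ball_vol_pos)
  finally show ?thesis .
qed

text \<open>The hyperplane x . z = -h, with h = |z|^2 / 2, is where \<open>x\<close> and
  \<open>z + x\<close> are equally long. Points of the ball with x . z at most -h stay inside
  (\<open>?L1\<close>). The other points that stay inside form \<open>?L2\<close>, and the shift by
  \<open>z\<close> maps it onto the cap \<open>?L2'\<close> beyond x . z = h. So the ball is split
  once into \<open>?S\<close>, \<open>?L1\<close>, \<open>?L2\<close> and once into
  \<open>?M\<close>, \<open>?L1\<close>, \<open>?L2'\<close>; cancelling finite volumes leaves vol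
  \<open>?S\<close> = vol \<open>?M\<close>. The slab \<open>?M\<close> has half-width |z| / 2,
  hence the argument |z| / (2R).\<close>

lemma emeasure_ball_Diff_shifted_ball:
  fixes z :: "'a::euclidean_space"
  assumes R: "R > 0" and dim: "DIM('a) \<ge> 2"
  shows "emeasure lborel {x::'a. norm x < R \<and> R \<le> norm (z + x)}
       = ennreal (unit_ball_vol DIM('a) * R ^ DIM('a) * slab_fraction DIM('a) (norm z / (2 * R)))"
proof (cases "z = 0")
  case True
  then have "{x::'a. norm x < R \<and> R \<le> norm (z + x)} = {}" by auto
  then have "emeasure lborel {x::'a. norm x < R \<and> R \<le> norm (z + x)} = 0"
    by (simp only: emeasure_empty)
  then show ?thesis using True by (simp add: slab_fraction_def)
next
  case False
  define h where "h = (norm z)\<^sup>2 / 2"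
  have nz: "(norm (z + x))\<^sup>2 = (norm x)\<^sup>2 + 2 * (x \<bullet> z) + 2 * h" for x
    by (simp add: h_def power2_norm_eq_inner inner_add_left inner_add_right inner_commute)
  let ?B = "{x::'a. norm x < R}"
  let ?S = "{x::'a. norm x < R \<and> R \<le> norm (z + x)}"
  let ?L1 = "{x::'a. norm x < R \<and> x \<bullet> z \<le> - h}"
  let ?L2 = "{x::'a. norm (z + x) < R \<and> - h < x \<bullet> z}"
  let ?L2' = "{x::'a. norm x < R \<and> h < x \<bullet> z}"
  let ?M = "{x::'a. norm x < R \<and> - h < x \<bullet> z \<and> x \<bullet> z \<le> h}"
  have [measurable]: "?S \<in> sets lborel" "?L1 \<in> sets lborel" "?L2 \<in> sets lborel" "?L2' \<in> sets lborel" "?M \<in> sets lborel"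
    by simp_all
  have lt1: "norm (z + x) \<le> norm x" if "x \<bullet> z \<le> - h" for x
    by (rule power2_le_imp_le) (use that nz[of x] in auto)
  have lt2: "norm x \<le> norm (z + x)" if "- h < x \<bullet> z" for x
    by (rule power2_le_imp_le) (use that nz[of x] in auto)
  have "emeasure lborel ?B = emeasure lborel (?S \<union> (?L1 \<union> ?L2))"
    by (rule arg_cong[of _ _ "emeasure lborel"]) (use lt1 lt2 in force)
  also have "\<dots> = emeasure lborel ?S + (emeasure lborel ?L1 + emeasure lborel ?L2)"
    using lt1 by (subst plus_emeasure[symmetric], simp, simp, force, subst plus_emeasure, simp, simp, force, simp)
  also have "emeasure lborel ?L2 = (\<integral>\<^sup>+x. indicator ?L2' (z + x) \<partial>lborel)"
  proof -
    have "(\<integral>\<^sup>+x. indicator ?L2' (z + x) \<partial>lborel) = (\<integral>\<^sup>+x. indicator ?L2 x \<partial>lborel)"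
      by (intro nn_integral_cong) (auto simp: indicator_def inner_add_left h_def power2_norm_eq_inner)
    then show ?thesis by simp
  qed
  also have "\<dots> = emeasure lborel ?L2'"
    by (subst nn_integral_lborel_shift) auto
  finally have 1: "emeasure lborel ?B = emeasure lborel ?S + (emeasure lborel ?L1 + emeasure lborel ?L2')" .
  have h: "h \<ge> 0" by (simp add: h_def)
  have "emeasure lborel ?B = emeasure lborel (?M \<union> (?L1 \<union> ?L2'))"
    by (rule arg_cong[of _ _ "emeasure lborel"]) (use h in force)
  also have "\<dots> = emeasure lborel ?M + (emeasure lborel ?L1 + emeasure lborel ?L2')"
    using h by (subst plus_emeasure[symmetric], simp, simp, force, subst plus_emeasure, simp, simp, force, simp)
  finally have 2: "emeasure lborel ?B = emeasure lborel ?M + (emeasure lborel ?L1 + emeasure lborel ?L2')" .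
  have "?B = ball 0 R" by auto
  then have "emeasure lborel ?B < \<infinity>" using emeasure_ball[of R "0::'a"] R by simp
  moreover define c where "c = emeasure lborel ?L1 + emeasure lborel ?L2'"
  ultimately have "c \<noteq> \<infinity>" and "c + emeasure lborel ?S = c + emeasure lborel ?M"
    using 1 2 by (auto simp: less_top add.commute[of c])
  then have "emeasure lborel ?S = emeasure lborel ?M"
    by (simp add: ennreal_add_left_cancel)
  also have "?M = {x. norm x < R \<and> - (norm z / 2) < x \<bullet> (z /\<^sub>R norm z) \<and> x \<bullet> (z /\<^sub>R norm z) \<le> norm z / 2}"
    using False by (auto simp: h_def field_simps power2_eq_square)
  also have "emeasure lborel \<dots> = ennreal (unit_ball_vol DIM('a) * R ^ DIM('a) * slab_fraction DIM('a) (norm z / 2 / R))"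
    using False R dim by (intro emeasure_ball_slab) auto
  finally show ?thesis by (simp add: mult.commute)
qed

section \<open>Radial integrals\<close>

text \<open>Polar coordinates obtained from ball volumes alone: both measures assign to {..a} the
  volume of the ball of radius max(0, a), and these rays generate the Borel sets. The density is the
  derivative of that volume.\<close>

lemma distr_lborel_norm:
  "distr (lborel :: 'a::euclidean_space measure) borel norm
     = density lborel (\<lambda>r. ennreal (DIM('a) * unit_ball_vol DIM('a) * r ^ (DIM('a) - 1)) * indicator {0..} r)"
    (is "?L = ?R")
proof (rule measure_eqI_generator_eq[of "range (\<lambda>a::real. {..a})" UNIV _ _ "\<lambda>i. {..real i}"])
  let ?n = "DIM('a)"
  have L: "emeasure ?L {..a} = ennreal (unit_ball_vol ?n * (max 0 a) ^ ?n)" for a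
  proof -
    have "norm -` {..a} = cball (0::'a) a" by auto
    then have "emeasure ?L {..a} = emeasure lborel (cball (0::'a) a)"
      by (simp add: emeasure_distr)
    then show ?thesis
      by (cases "a < 0") (auto simp: emeasure_cball max_def)
  qed
  have R: "emeasure ?R {..a} = ennreal (unit_ball_vol ?n * (max 0 a) ^ ?n)" for a
  proof -
    have "emeasure ?R {..a} = (\<integral>\<^sup>+r. ennreal (?n * unit_ball_vol ?n * r ^ (?n - 1)) * indicator {0..} r * indicator {..a} r \<partial>lborel)"
      by (subst emeasure_density) auto
    also have "\<dots> = (\<integral>\<^sup>+r. ennreal (?n * unit_ball_vol ?n * r ^ (?n - 1)) * indicator {0..max 0 a} r \<partial>lborel)"
    proof (rule nn_integral_cong_AE)
      \<comment> \<open>For negative \<open>a\<close> the interval {0..max 0 a} still contains 0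
        although {..a} does not.\<close>
      have "AE r in lborel. r \<notin> {0::real}"
        by (intro AE_not_in countable_imp_null_set_lborel) auto
      then show "AE r in lborel. ennreal (?n * unit_ball_vol ?n * r ^ (?n - 1)) * indicator {0..} r * indicator {..a} r =
          ennreal (?n * unit_ball_vol ?n * r ^ (?n - 1)) * indicator {0..max 0 a} r"
        by eventually_elim (auto simp: indicator_def)
    qed
    also have "\<dots> = ennreal (unit_ball_vol ?n * max 0 a ^ ?n - unit_ball_vol ?n * 0 ^ ?n)"
      by (intro nn_integral_FTC_Icc) (auto intro!: derivative_eq_intros)
    finally show ?thesis by simp
  qed
  show "emeasure ?L X = emeasure ?R X" if "X \<in> range (\<lambda>a::real. {..a})" for X
    using that L R by auto
  show "emeasure ?L {..real i} \<noteq> \<infinity>" for i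
    by (simp add: L)
  show "Int_stable (range (\<lambda>a::real. {..a}))"
    by (auto simp: Int_stable_def)
  show "sets ?L = sigma_sets UNIV (range (\<lambda>a::real. {..a}))"
    by (simp add: borel_eq_atMost)
  show "sets ?R = sigma_sets UNIV (range (\<lambda>a::real. {..a}))"
    using borel_eq_atMost[where 'a=real] by (simp add: borel_eq_atMost)
  show "(\<Union>i. {..real i}) = UNIV"
    using real_arch_simple by auto
qed auto

lemma nn_integral_radial:
  assumes [measurable]: "f \<in> borel_measurable borel"
  shows "(\<integral>\<^sup>+x. f (norm x) \<partial>(lborel :: 'a::euclidean_space measure))
    = (\<integral>\<^sup>+r. ennreal (DIM('a) * unit_ball_vol DIM('a) * r ^ (DIM('a) - 1)) * indicator {0..} r * f r \<partial>lborel)"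
proof -
  have "(\<integral>\<^sup>+x. f (norm x) \<partial>(lborel :: 'a measure)) = (\<integral>\<^sup>+r. f r \<partial>distr (lborel :: 'a measure) borel norm)"
    by (simp add: nn_integral_distr)
  then show ?thesis
    unfolding distr_lborel_norm by (simp add: nn_integral_density)
qed

text \<open>The hypothesis has the shape of the known half-line Gaussian moments; the surface factor
  r^(n - 1) only raises the exponent, so the parity of n decides which of them applies.\<close>

lemma has_bochner_integral_radial_gaussian:
  assumes "has_bochner_integral lborel (\<lambda>r::real. indicator {0..} r *\<^sub>R (exp (-r\<^sup>2) * r ^ (k + (DIM('a) - 1)))) I"
  shows "has_bochner_integral lborel (\<lambda>x::'a::euclidean_space. exp (-(norm x)\<^sup>2) * norm x ^ k)
           (DIM('a) * unit_ball_vol DIM('a) * I)"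
proof (rule has_bochner_integral_nn_integral)
  let ?c = "DIM('a) * unit_ball_vol DIM('a)"
  let ?g = "\<lambda>r::real. indicator {0..} r *\<^sub>R (exp (-r\<^sup>2) * r ^ (k + (DIM('a) - 1)))"
  have nn: "?g r \<ge> 0" for r by (auto simp: indicator_def)
  have int: "integrable lborel ?g" and I: "integral\<^sup>L lborel ?g = I"
    using assms by (auto simp: has_bochner_integral_iff)
  have eq: "(\<integral>\<^sup>+r. ennreal (?g r) \<partial>lborel) = ennreal I"
    using nn_integral_eq_integral[OF int AE_I2[OF nn]] unfolding I .
  show "0 \<le> ?c * I"
    unfolding I[symmetric] by (intro mult_nonneg_nonneg integral_nonneg_AE) (use nn in auto)
  have "(\<integral>\<^sup>+x. ennreal (exp (-(norm x)\<^sup>2) * norm x ^ k) \<partial>(lborel :: 'a measure))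
     = (\<integral>\<^sup>+r. ennreal (?c * r ^ (DIM('a) - 1)) * indicator {0..} r * ennreal (exp (-r\<^sup>2) * r ^ k) \<partial>lborel)"
    by (rule nn_integral_radial) simp
  also have "\<dots> = (\<integral>\<^sup>+r. ennreal ?c * ennreal (?g r) \<partial>lborel)"
    unfolding power_add by (intro nn_integral_cong) (auto simp: indicator_def mult_ac simp flip: ennreal_mult)
  also have "\<dots> = ennreal ?c * ennreal I"
    unfolding eq[symmetric] by (rule nn_integral_cmult) measurable
  also have "\<dots> = ennreal (?c * I)"
    by (rule ennreal_mult'[symmetric]) simp
  finally show "(\<integral>\<^sup>+x. ennreal (exp (-(norm x)\<^sup>2) * norm x ^ k) \<partial>(lborel :: 'a measure)) = ennreal (?c * I)" .
qed auto

section \<open>Factorial moments of determinantal point processes\<close>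

lemma det_n_1: "det_n 1 A = A 0 0"
proof -
  have "{p. p permutes {..<1::nat}} = {id}"
    by (auto simp: lessThan_Suc)
  then show ?thesis by (simp add: det_n_def)
qed

lemma det_n_2: "det_n 2 A = A 0 0 * A 1 1 - A 0 1 * A 1 0"
proof -
  have two: "{..<2::nat} = {0, 1}" by auto
  have P: "{p. p permutes {..<2::nat}} = {id, Transposition.transpose 0 1}"
    unfolding two by (auto simp: permutes_doubleton_iff)
  have ne: "id \<noteq> Transposition.transpose 0 (1::nat)"
    by (metis id_apply transpose_apply_first zero_neq_one)
  show ?thesis
    unfolding det_n_def P using ne
    by (simp add: two sign_swap_id)
qed

lemma card_PiE_1:
  "card {g \<in> {..<1::nat} \<rightarrow>\<^sub>E S. inj_on g {..<1}} = card S"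
proof -
  have one: "{..<1::nat} = {0}" by auto
  have "bij_betw (\<lambda>x. \<lambda>i\<in>{0}. x) S {g \<in> {..<1::nat} \<rightarrow>\<^sub>E S. inj_on g {..<1}}"
    unfolding one
    by (rule bij_betw_byWitness[where f' = "\<lambda>g. g 0"]) (auto simp: PiE_def extensional_def fun_eq_iff)
  then show ?thesis by (simp add: bij_betw_same_card)
qed

lemma card_PiE_2:
  assumes "finite S"
  shows "card {g \<in> {..<2::nat} \<rightarrow>\<^sub>E S. inj_on g {..<2}} = card S * (card S - 1)"
proof -
  have two: "{..<2::nat} = {0, 1}" by auto
  have "bij_betw (\<lambda>(x, y). \<lambda>i\<in>{0, 1}. if i = 0 then x else y) (SIGMA x:S. S - {x})
     {g \<in> {..<2::nat} \<rightarrow>\<^sub>E S. inj_on g {..<2}}"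
    unfolding two
    by (rule bij_betw_byWitness[where f' = "\<lambda>g. (g 0, g 1)"])
       (auto simp: PiE_def extensional_def fun_eq_iff)
  then have "card {g \<in> {..<2::nat} \<rightarrow>\<^sub>E S. inj_on g {..<2}} = card (SIGMA x:S. S - {x})"
    by (simp add: bij_betw_same_card)
  also have "\<dots> = card S * (card S - 1)"
    using assms by (subst card_SigmaI) auto
  finally show ?thesis .
qed

text \<open>Testing a correlation function against the indicator of B^n turns the sum over distinct
  tuples into a falling factorial of the number of points in \<open>B\<close>. \<open>X\<close>
  itself may be infinite; tuples leaving \<open>B\<close> contribute 0.\<close>

lemma nn_integral_injective_tuples:
  fixes n :: nat
  assumes "finite (X \<inter> B)"
  shows "(\<integral>\<^sup>+g. (\<Prod>i<n. indicator B (g i)) \<partial>count_space {g \<in> {..<n} \<rightarrow>\<^sub>E X. inj_on g {..<n}})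
     = ennreal (card {g \<in> {..<n} \<rightarrow>\<^sub>E X \<inter> B. inj_on g {..<n}})"
proof -
  let ?G = "{g \<in> {..<n} \<rightarrow>\<^sub>E X. inj_on g {..<n}}" and ?H = "{g \<in> {..<n} \<rightarrow>\<^sub>E X \<inter> B. inj_on g {..<n}}"
  have fin: "finite ?H"
    using assms by (intro finite_subset[OF _ finite_PiE[of "{..<n}" "\<lambda>_. X \<inter> B"]]) auto
  have "(\<integral>\<^sup>+g. (\<Prod>i<n. indicator B (g i)) \<partial>count_space ?G) = (\<integral>\<^sup>+g. indicator ?H g \<partial>count_space ?G)"
  proof (rule nn_integral_cong)
    fix g assume "g \<in> space (count_space ?G)"
    then have g: "g \<in> ?G" by simp
    show "(\<Prod>i<n. indicator B (g i)) = (indicator ?H g :: ennreal)"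
    proof (cases "\<forall>i<n. g i \<in> B")
      case True
      then have "g \<in> ?H" using g by (auto simp: PiE_iff)
      then show ?thesis using True by simp
    next
      case False
      then obtain i where "i < n" "g i \<notin> B" by auto
      moreover from this have "g \<notin> ?H" by (auto simp: PiE_iff)
      ultimately show ?thesis by (auto intro!: prod_zero bexI[of _ i])
    qed
  qed
  also have "\<dots> = emeasure (count_space ?G) ?H"
    by (rule nn_integral_indicator) (auto simp: PiE_iff)
  also have "\<dots> = card ?H"
    using fin by (subst emeasure_count_space_finite) (auto simp: PiE_iff)
  finally show ?thesis by (simp add: ennreal_of_nat_eq_real_of_nat)
qed

context
  fixes M :: "'w measure" and Xi :: "'w \<Rightarrow> 'a::euclidean_space set" and lam :: "'a measure" and K and B :: "'a set"
  assumes DPP: "is_DPP M Xi lam K" and B: "B \<in> sets borel" "bounded B"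
    and lam: "sigma_finite_measure lam" "sets lam = sets borel"
begin

lemma DPP_factorial_moment:
  assumes "n \<ge> 1"
  shows "(\<integral>\<^sup>+\<omega>. ennreal (card {g \<in> {..<n} \<rightarrow>\<^sub>E Xi \<omega> \<inter> B. inj_on g {..<n}}) \<partial>M)
    = (\<integral>\<^sup>+x. (\<Prod>i<n. indicator B (x i)) * ennreal (Re (det_n n (\<lambda>i j. K (x i) (x j)))) \<partial>PiM {..<n} (\<lambda>_. lam))"
proof -
  have fin: "finite (Xi \<omega> \<inter> B)" if "\<omega> \<in> space M" for \<omega>
    using DPP B that by (auto simp: is_DPP_def)
  note [measurable] = B(1)
  have "(\<lambda>x. \<Prod>i<n. indicator B (x i) :: ennreal) \<in> borel_measurable (PiM {..<n} (\<lambda>_. borel))"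
    by measurable
  with DPP assms have "(\<integral>\<^sup>+\<omega>. (\<integral>\<^sup>+g. (\<Prod>i<n. indicator B (g i)) \<partial>count_space
              {g \<in> {..<n} \<rightarrow>\<^sub>E Xi \<omega>. inj_on g {..<n}}) \<partial>M)
        = (\<integral>\<^sup>+x. (\<Prod>i<n. indicator B (x i)) * ennreal (Re (det_n n (\<lambda>i j. K (x i) (x j)))) \<partial>PiM {..<n} (\<lambda>_. lam))"
    unfolding is_DPP_def by blast
  moreover have "(\<integral>\<^sup>+\<omega>. (\<integral>\<^sup>+g. (\<Prod>i<n. indicator B (g i)) \<partial>count_space
              {g \<in> {..<n} \<rightarrow>\<^sub>E Xi \<omega>. inj_on g {..<n}}) \<partial>M)
       = (\<integral>\<^sup>+\<omega>. ennreal (card {g \<in> {..<n} \<rightarrow>\<^sub>E Xi \<omega> \<inter> B. inj_on g {..<n}}) \<partial>M)"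
    using fin assms by (intro nn_integral_cong nn_integral_injective_tuples) auto
  ultimately show ?thesis by simp
qed

lemma DPP_first_moment:
  assumes [measurable]: "(\<lambda>x. K x x) \<in> borel_measurable borel"
  shows "(\<integral>\<^sup>+\<omega>. ennreal (card (Xi \<omega> \<inter> B)) \<partial>M)
    = (\<integral>\<^sup>+x. indicator B x * ennreal (Re (K x x)) \<partial>lam)"
proof -
  interpret sigma_finite_measure lam by fact
  interpret product_sigma_finite "\<lambda>_. lam" by standard
  have one: "{..<1::nat} = {0}" by auto
  note [measurable_cong] = lam(2)
  note [measurable] = B(1)
  have "(\<lambda>x. indicator B x * ennreal (Re (K x x))) \<in> borel_measurable lam"
    by measurable
  from product_nn_integral_singleton[OF this, of "0::nat"]
  show ?thesis
    using DPP_factorial_moment[of 1] unfolding card_PiE_1 det_n_1 by (simp add: lessThan_Suc)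
qed

lemma DPP_second_factorial_moment:
  assumes [measurable]: "(\<lambda>(x, y). K x y) \<in> borel_measurable (borel \<Otimes>\<^sub>M borel)"
  shows "(\<integral>\<^sup>+\<omega>. ennreal (card (Xi \<omega> \<inter> B) * (card (Xi \<omega> \<inter> B) - 1)) \<partial>M)
    = (\<integral>\<^sup>+x. \<integral>\<^sup>+y. indicator B x * indicator B y * ennreal (Re (K x x * K y y - K x y * K y x)) \<partial>lam \<partial>lam)"
proof -
  interpret sigma_finite_measure lam by fact
  interpret product_sigma_finite "\<lambda>_. lam" by standard
  have two: "{..<2::nat} = {0, 1}" by auto
  \<comment> \<open>Index 1 is the inserted one, so the second point becomes the inner integration
    variable.\<close>
  have two': "{..<2::nat} = insert 1 {0}" by auto
  note [measurable_cong] = lam(2)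
  note [measurable] = B(1)
  have [measurable]: "(\<lambda>x. K (f x) (g x)) \<in> borel_measurable N"
    if [measurable]: "f \<in> measurable N borel" "g \<in> measurable N borel" for f g and N :: "'b measure"
  proof -
    have "(\<lambda>x. (case (f x, g x) of (x, y) \<Rightarrow> K x y)) \<in> borel_measurable N"
      by measurable
    then show ?thesis by simp
  qed
  have fin: "finite (Xi \<omega> \<inter> B)" if "\<omega> \<in> space M" for \<omega>
    using DPP B that by (auto simp: is_DPP_def)
  let ?f = "\<lambda>x y. indicator B x * indicator B y * ennreal (Re (K x x * K y y - K x y * K y x))"
  have "(\<integral>\<^sup>+\<omega>. ennreal (card (Xi \<omega> \<inter> B) * (card (Xi \<omega> \<inter> B) - 1)) \<partial>M)
     = (\<integral>\<^sup>+\<omega>. ennreal (card {g \<in> {..<2} \<rightarrow>\<^sub>E Xi \<omega> \<inter> B. inj_on g {..<2::nat}}) \<partial>M)"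
    by (intro nn_integral_cong) (simp add: card_PiE_2 fin)
  also have "\<dots> = (\<integral>\<^sup>+x. ?f (x 0) (x 1) \<partial>PiM {..<2::nat} (\<lambda>_. lam))"
    unfolding DPP_factorial_moment[of 2, simplified] det_n_2 by (simp add: two)
  also have "\<dots> = (\<integral>\<^sup>+x. (\<integral>\<^sup>+y. ?f ((x(1 := y)) 0) ((x(1 := y)) 1) \<partial>lam) \<partial>PiM {0::nat} (\<lambda>_. lam))"
    unfolding two' by (intro product_nn_integral_insert) auto
  also have "\<dots> = (\<integral>\<^sup>+x. (\<integral>\<^sup>+y. ?f (x 0) y \<partial>lam) \<partial>PiM {0::nat} (\<lambda>_. lam))"
    by simp
  also have "\<dots> = (\<integral>\<^sup>+x. \<integral>\<^sup>+y. ?f x y \<partial>lam \<partial>lam)"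
    by (intro product_nn_integral_singleton) measurable
  finally show ?thesis .
qed

end

section \<open>Number variance of the Heisenberg process\<close>

text \<open>Monotonicity suffices: the profile is nonnegative and the intervals grow with
  \<open>s\<close>. For negative \<open>s\<close> the interval is empty and the value is 0.\<close>

lemma borel_measurable_slab_fraction [measurable]:
  assumes "n > 0"
  shows "slab_fraction n \<in> borel_measurable borel"
proof (rule borel_measurable_mono, rule monoI)
  fix s t :: real assume "s \<le> t"
  then have "integral {-s..s} (ball_profile n) \<le> integral {-t..t} (ball_profile n)"
    by (intro integral_subset_le integrable_continuous_interval continuous_intros)
       (auto simp: ball_profile_nonneg)
  then show "slab_fraction n s \<le> slab_fraction n t"
    using assms unfolding slab_fraction_def by (intro mult_left_mono divide_nonneg_nonneg) auto
qed

lemma nn_integral_gaussian_across_sphere: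
  assumes R: "R > 0" and dim: "DIM('a::euclidean_space) \<ge> 2"
  shows "(\<integral>\<^sup>+x. \<integral>\<^sup>+y. indicator (ball 0 R) x * indicator (- ball 0 R) y * ennreal (exp (-(norm (x - y))\<^sup>2))
            \<partial>(lborel :: 'a measure) \<partial>(lborel :: 'a measure))
       = ennreal (unit_ball_vol DIM('a) * R ^ DIM('a)) *
         (\<integral>\<^sup>+z. ennreal (exp (-(norm z)\<^sup>2) * slab_fraction DIM('a) (norm z / (2 * R))) \<partial>(lborel :: 'a measure))"
proof -
  let ?v = "unit_ball_vol DIM('a) * R ^ DIM('a)"
  have [measurable]: "ball (0::'a) R \<in> sets borel" by simp
  have [measurable]: "slab_fraction DIM('a) \<in> borel_measurable borel" by simp
  have [measurable]: "(\<lambda>x::'a \<times> 'a. indicator (- ball (0::'a) R) (fst x + snd x) :: ennreal) \<in> borel_measurable (borel \<Otimes>\<^sub>M borel)"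
    by measurable
  have "(\<integral>\<^sup>+x. \<integral>\<^sup>+y. indicator (ball 0 R) x * indicator (- ball 0 R) y * ennreal (exp (-(norm (x - y))\<^sup>2))
            \<partial>(lborel :: 'a measure) \<partial>(lborel :: 'a measure))
     = (\<integral>\<^sup>+x. \<integral>\<^sup>+z. indicator (ball 0 R) x * indicator (- ball 0 R) (x + z) * ennreal (exp (-(norm z)\<^sup>2))
            \<partial>(lborel :: 'a measure) \<partial>(lborel :: 'a measure))"
  proof (rule nn_integral_cong)
    fix x :: 'a
    show "(\<integral>\<^sup>+y. indicator (ball 0 R) x * indicator (- ball 0 R) y * ennreal (exp (-(norm (x - y))\<^sup>2)) \<partial>lborel)
     = (\<integral>\<^sup>+z. indicator (ball 0 R) x * indicator (- ball 0 R) (x + z) * ennreal (exp (-(norm z)\<^sup>2)) \<partial>lborel)"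
      by (subst nn_integral_lborel_shift[of _ x, symmetric]) simp_all
  qed
  also have "\<dots> = (\<integral>\<^sup>+z. \<integral>\<^sup>+x. indicator (ball 0 R) x * indicator (- ball 0 R) (x + z) * ennreal (exp (-(norm z)\<^sup>2))
            \<partial>(lborel :: 'a measure) \<partial>(lborel :: 'a measure))"
    by (intro lborel_pair.Fubini') measurable
  also have "\<dots> = (\<integral>\<^sup>+z. ennreal ?v * ennreal (exp (-(norm z)\<^sup>2) * slab_fraction DIM('a) (norm z / (2 * R))) \<partial>(lborel :: 'a measure))"
  proof (rule nn_integral_cong)
    fix z :: 'a
    let ?S = "{x::'a. norm x < R \<and> R \<le> norm (z + x)}"
    have "(\<integral>\<^sup>+x. indicator (ball 0 R) x * indicator (- ball 0 R) (x + z) * ennreal (exp (-(norm z)\<^sup>2)) \<partial>lborel)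
       = (\<integral>\<^sup>+x. indicator ?S x * ennreal (exp (-(norm z)\<^sup>2)) \<partial>lborel)"
      by (intro nn_integral_cong) (auto simp: indicator_def add.commute)
    also have "\<dots> = emeasure lborel ?S * ennreal (exp (-(norm z)\<^sup>2))"
      by (subst nn_integral_multc) auto
    also have "emeasure lborel ?S = ennreal (?v * slab_fraction DIM('a) (norm z / (2 * R)))"
      by (rule emeasure_ball_Diff_shifted_ball[OF R dim])
    finally show "(\<integral>\<^sup>+x. indicator (ball 0 R) x * indicator (- ball 0 R) (x + z) * ennreal (exp (-(norm z)\<^sup>2)) \<partial>lborel)
      = ennreal ?v * ennreal (exp (-(norm z)\<^sup>2) * slab_fraction DIM('a) (norm z / (2 * R)))"
      using R by (simp add: slab_fraction_nonneg mult_ac flip: ennreal_mult)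
  qed
  also have "\<dots> = ennreal ?v * (\<integral>\<^sup>+z. ennreal (exp (-(norm z)\<^sup>2) * slab_fraction DIM('a) (norm z / (2 * R))) \<partial>(lborel :: 'a measure))"
    by (rule nn_integral_cmult) measurable
  finally show ?thesis .
qed

lemma has_bochner_integral_gaussian:
  assumes "DIM('a::euclidean_space) = 2 * D"
  shows "has_bochner_integral lborel (\<lambda>x::'a. exp (-(norm x)\<^sup>2)) (pi ^ D)"
proof -
  have D: "D > 0" using assms DIM_positive[where 'a='a] by linarith
  then have "2 * (D - 1) + 1 = 0 + (DIM('a) - 1)" using assms by simp
  then have "has_bochner_integral lborel (\<lambda>x::'a. exp (-(norm x)\<^sup>2) * norm x ^ 0)
      (DIM('a) * unit_ball_vol DIM('a) * (fact (D - 1) / 2))"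
    using gaussian_moment_odd_pos[of "D - 1"] by (intro has_bochner_integral_radial_gaussian) metis
  also have "DIM('a) * unit_ball_vol DIM('a) * (fact (D - 1) / 2) = pi ^ D"
    using D unfolding assms unit_ball_vol_even by (simp add: fact_reduce[of D])
  finally show ?thesis by simp
qed

section \<open>The Heisenberg kernel and its reference measure\<close>

lemma inner_eq_Re_cdot: "x \<bullet> y = Re (cdot x y)"
  by (simp add: inner_vec_def cdot_def inner_complex_def)

lemma cdot_commute: "cdot y x = cnj (cdot x y)"
  by (simp add: cdot_def mult.commute)

lemma heis_kernel_diag: "heis_kernel x x = of_real (exp ((norm x)\<^sup>2))"
proof -
  have "cdot x x = of_real (x \<bullet> x)"
    using cdot_commute[of x x] by (simp add: complex_eq_iff inner_eq_Re_cdot)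
  then show ?thesis by (simp add: heis_kernel_def power2_norm_eq_inner exp_of_real)
qed

text \<open>The kernel is Hermitian, so the phases cancel and only the real inner product survives
  in the 2 x 2 determinant.\<close>

lemma heis_kernel_mult_swap: "heis_kernel x y * heis_kernel y x = of_real (exp (2 * (x \<bullet> y)))"
proof -
  have "cdot x y + cdot y x = of_real (2 * (x \<bullet> y))"
    by (simp add: cdot_commute[of y x] inner_eq_Re_cdot complex_eq_iff)
  then show ?thesis by (simp only: heis_kernel_def exp_add[symmetric] exp_of_real)
qed

lemma borel_measurable_heis_kernel [measurable]:
  "(\<lambda>(x, y). heis_kernel x y) \<in> borel_measurable (borel \<Otimes>\<^sub>M borel)"
  unfolding borel_prod split_beta heis_kernel_def cdot_def
  by (intro borel_measurable_continuous_onI continuous_intros)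

lemma sigma_finite_heis_ref: "sigma_finite_measure (heis_ref :: (complex ^ 'd) measure)"
  unfolding heis_ref_def 
  by (subst sigma_finite_measure.sigma_finite_iff_density_finite[OF sigma_finite_lborel]) auto

lemma nn_integral_heis_ref:
  fixes f :: "complex ^ 'd \<Rightarrow> ennreal"
  assumes "f \<in> borel_measurable borel"
  shows "(\<integral>\<^sup>+x. f x \<partial>heis_ref) = (\<integral>\<^sup>+x. ennreal (exp (-(norm x)\<^sup>2) / pi ^ CARD('d)) * f x \<partial>lborel)"
  using assms unfolding heis_ref_def
  by (subst nn_integral_density) (auto simp: powr_minus powr_realpow divide_inverse mult.commute)

text \<open>Let \<open>m\<close> be the mean, \<open>A\<close> the second factorial moment,
  \<open>F\<close> the normalised Gaussian integral over the ball times the ball, and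
  \<open>G\<close> the one across the sphere. Then A + F = m^2 and F + G = m, so the variance A + m
  - m^2 equals \<open>G\<close>. Writing both identities as sums avoids truncated subtraction in
  \<open>ennreal\<close>, and finiteness of all three terms follows from them.\<close>

lemma heis_number_statistics:
  fixes M :: "'w measure" and Xi :: "'w \<Rightarrow> (complex ^ 'd) set"
  assumes DPP: "is_DPP M Xi heis_ref heis_kernel" and R: "R > 0"
  defines "N \<equiv> \<lambda>\<omega>. real (card (Xi \<omega> \<inter> ball 0 R))"
  shows heis_expectation: "prob_space.expectation M N = R ^ (2 * CARD('d)) / fact CARD('d)"
    and heis_variance: "prob_space.variance M N = prob_space.expectation M N / pi ^ CARD('d) *
     (LINT z|(lborel :: (complex ^ 'd) measure). exp (-(norm z)\<^sup>2) * slab_fraction (2 * CARD('d)) (norm z / (2 * R)))"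
proof -
  let ?B = "ball (0 :: complex ^ 'd) R" and ?L = "lborel :: (complex ^ 'd) measure"
  let ?D = "CARD('d)"
  have dim: "DIM(complex ^ 'd) = 2 * ?D" by simp
  have dim2: "DIM(complex ^ 'd) \<ge> 2" using zero_less_card_finite[where 'a='d] unfolding dim by linarith
  interpret prob_space M using DPP by (simp add: is_DPP_def)
  have B [measurable]: "?B \<in> sets borel" by simp
  have N [measurable]: "N \<in> borel_measurable M"
    using DPP by (simp add: is_DPP_def N_def)
  have sets: "sets (heis_ref :: (complex ^ 'd) measure) = sets borel" by (simp add: heis_ref_def)
  have N_nonneg: "N \<omega> \<ge> 0" for \<omega> by (simp add: N_def)
  note DPP' = DPP B bounded_ball sigma_finite_heis_ref sets
  define v where "v = unit_ball_vol (2 * ?D) * R ^ (2 * ?D)"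
  define m where "m = v / pi ^ ?D"
  have v0: "v \<ge> 0" using R by (simp add: v_def)
  then have m0: "m \<ge> 0" by (simp add: m_def)
  have meas_B: "emeasure ?L ?B = ennreal v"
    using R unfolding v_def by (subst emeasure_ball) (auto simp: dim mult.commute)
  let ?e = "\<lambda>x y :: complex ^ 'd. exp (-(norm (x - y))\<^sup>2)"
  let ?p = "1 / (pi ^ ?D * pi ^ ?D)"
  define A where "A = (\<integral>\<^sup>+x. \<integral>\<^sup>+y. indicator ?B x * indicator ?B y * ennreal (?p * (1 - ?e x y)) \<partial>?L \<partial>?L)"
  define F where "F = (\<integral>\<^sup>+x. \<integral>\<^sup>+y. indicator ?B x * indicator ?B y * ennreal (?p * ?e x y) \<partial>?L \<partial>?L)"
  define G where "G = (\<integral>\<^sup>+x. \<integral>\<^sup>+y. indicator ?B x * indicator (- ?B) y * ennreal (?p * ?e x y) \<partial>?L \<partial>?L)"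
  have EN: "(\<integral>\<^sup>+\<omega>. ennreal (N \<omega>) \<partial>M) = ennreal m"
  proof -
    have "(\<integral>\<^sup>+\<omega>. ennreal (N \<omega>) \<partial>M) = (\<integral>\<^sup>+x. indicator ?B x * ennreal (Re (heis_kernel x x)) \<partial>heis_ref)"
      unfolding N_def by (rule DPP_first_moment[OF DPP']) (simp add: heis_kernel_diag)
    also have "\<dots> = (\<integral>\<^sup>+x. ennreal (exp (-(norm x)\<^sup>2) / pi ^ ?D) * (indicator ?B x * ennreal (exp ((norm x)\<^sup>2))) \<partial>?L)"
      by (subst nn_integral_heis_ref) (auto simp: heis_kernel_diag)
    also have "\<dots> = (\<integral>\<^sup>+x. ennreal (1 / pi ^ ?D) * indicator ?B x \<partial>?L)"
      by (intro nn_integral_cong) (auto simp: indicator_def exp_minus simp flip: ennreal_mult)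
    also have "\<dots> = ennreal (1 / pi ^ ?D) * ennreal v"
      by (subst nn_integral_cmult) (auto simp: meas_B)
    also have "\<dots> = ennreal m" using v0 by (simp add: m_def flip: ennreal_mult)
    finally show ?thesis .
  qed
  have EN2: "(\<integral>\<^sup>+\<omega>. ennreal (N \<omega> * (N \<omega> - 1)) \<partial>M) = A"
  proof -
    \<comment> \<open>For an empty configuration the natural-number subtraction truncates, but the
      factor 0 makes both sides vanish.\<close>
    have "N \<omega> * (N \<omega> - 1) = real (card (Xi \<omega> \<inter> ?B) * (card (Xi \<omega> \<inter> ?B) - 1))" for \<omega>
      by (cases "card (Xi \<omega> \<inter> ?B)") (auto simp: N_def algebra_simps)
    then have "(\<integral>\<^sup>+\<omega>. ennreal (N \<omega> * (N \<omega> - 1)) \<partial>M)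
       = (\<integral>\<^sup>+x. \<integral>\<^sup>+y. indicator ?B x * indicator ?B y *
           ennreal (Re (heis_kernel x x * heis_kernel y y - heis_kernel x y * heis_kernel y x)) \<partial>heis_ref \<partial>heis_ref)"
      by (simp only:) (rule DPP_second_factorial_moment[OF DPP'], measurable)
    also have "\<dots> = (\<integral>\<^sup>+x. \<integral>\<^sup>+y. indicator ?B x * indicator ?B y *
           ennreal (exp ((norm x)\<^sup>2) * exp ((norm y)\<^sup>2) - exp (2 * (x \<bullet> y))) \<partial>heis_ref \<partial>heis_ref)"
      by (simp add: heis_kernel_mult_swap heis_kernel_diag)
    also have "\<dots> = (\<integral>\<^sup>+x. ennreal (exp (-(norm x)\<^sup>2) / pi ^ ?D) * (\<integral>\<^sup>+y. ennreal (exp (-(norm y)\<^sup>2) / pi ^ ?D) *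
          (indicator ?B x * indicator ?B y *
           ennreal (exp ((norm x)\<^sup>2) * exp ((norm y)\<^sup>2) - exp (2 * (x \<bullet> y)))) \<partial>?L) \<partial>?L)"
      by (simp add: nn_integral_heis_ref)
    also have "\<dots> = A"
      unfolding A_def
    proof (rule nn_integral_cong)
      fix x
      have eq: "ennreal (exp (-(norm x)\<^sup>2) / pi ^ ?D) * (ennreal (exp (-(norm y)\<^sup>2) / pi ^ ?D) *
          (indicator ?B x * indicator ?B y *
           ennreal (exp ((norm x)\<^sup>2) * exp ((norm y)\<^sup>2) - exp (2 * (x \<bullet> y)))))
         = indicator ?B x * indicator ?B y * ennreal (?p * (1 - ?e x y))" for y
      proof -
        \<comment> \<open>This identity makes the weighted determinant a function of x - y alone. It
          also shows that the determinant is nonnegative, which allows the factors to be multiplied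
          inside \<open>ennreal\<close>.\<close>
        have n: "(norm (x - y))\<^sup>2 = (norm x)\<^sup>2 + (norm y)\<^sup>2 - 2 * (x \<bullet> y)"
          by (simp add: power2_norm_eq_inner inner_diff_left inner_diff_right inner_commute)
        have "2 * (x \<bullet> y) \<le> (norm x)\<^sup>2 + (norm y)\<^sup>2"
          using n zero_le_power2[of "norm (x - y)"] by linarith
        then have "exp (2 * (x \<bullet> y)) \<le> exp ((norm x)\<^sup>2) * exp ((norm y)\<^sup>2)"
          by (simp flip: exp_add)
        moreover have "exp (-(norm x)\<^sup>2) / pi ^ ?D * (exp (-(norm y)\<^sup>2) / pi ^ ?D *
            (exp ((norm x)\<^sup>2) * exp ((norm y)\<^sup>2) - exp (2 * (x \<bullet> y)))) = ?p * (1 - ?e x y)"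
          unfolding n by (simp add: exp_minus exp_add exp_diff field_simps)
        ultimately show ?thesis
          by (auto simp: indicator_def simp flip: ennreal_mult)
      qed
      show "ennreal (exp (-(norm x)\<^sup>2) / pi ^ ?D) * (\<integral>\<^sup>+y. ennreal (exp (-(norm y)\<^sup>2) / pi ^ ?D) *
          (indicator ?B x * indicator ?B y *
           ennreal (exp ((norm x)\<^sup>2) * exp ((norm y)\<^sup>2) - exp (2 * (x \<bullet> y)))) \<partial>?L)
        = (\<integral>\<^sup>+y. indicator ?B x * indicator ?B y * ennreal (?p * (1 - ?e x y)) \<partial>?L)"
        by (subst nn_integral_cmult[symmetric]) (auto simp only: eq intro!: borel_measurable_times, measurable)
    qed
    finally show ?thesis .
  qed
  have AF: "A + F = ennreal (m\<^sup>2)"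
  proof -
    have "A + F = (\<integral>\<^sup>+x. (\<integral>\<^sup>+y. indicator ?B x * indicator ?B y * ennreal (?p * (1 - ?e x y)) \<partial>?L) +
          (\<integral>\<^sup>+y. indicator ?B x * indicator ?B y * ennreal (?p * ?e x y) \<partial>?L) \<partial>?L)"
      unfolding A_def F_def by (rule nn_integral_add[symmetric]) measurable
    also have "\<dots> = (\<integral>\<^sup>+x. \<integral>\<^sup>+y. (ennreal ?p * indicator ?B x) * indicator ?B y \<partial>?L \<partial>?L)"
    proof (rule nn_integral_cong)
      fix x
      have "(\<integral>\<^sup>+y. indicator ?B x * indicator ?B y * ennreal (?p * (1 - ?e x y)) \<partial>?L) +
          (\<integral>\<^sup>+y. indicator ?B x * indicator ?B y * ennreal (?p * ?e x y) \<partial>?L)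
         = (\<integral>\<^sup>+y. indicator ?B x * indicator ?B y * ennreal (?p * (1 - ?e x y)) + 
                 indicator ?B x * indicator ?B y * ennreal (?p * ?e x y) \<partial>?L)"
        by (rule nn_integral_add[symmetric]) measurable
      also have "\<dots> = (\<integral>\<^sup>+y. (ennreal ?p * indicator ?B x) * indicator ?B y \<partial>?L)"
      proof (rule nn_integral_cong)
        fix y
        have "ennreal (?p * (1 - ?e x y)) + ennreal (?p * ?e x y) = ennreal ?p"
          by (subst ennreal_plus[symmetric]) (auto simp: field_simps)
        then show "indicator ?B x * indicator ?B y * ennreal (?p * (1 - ?e x y)) + 
                 indicator ?B x * indicator ?B y * ennreal (?p * ?e x y) = (ennreal ?p * indicator ?B x) * indicator ?B y"
          by (auto simp: indicator_def)
      qed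
      finally show "(\<integral>\<^sup>+y. indicator ?B x * indicator ?B y * ennreal (?p * (1 - ?e x y)) \<partial>?L) +
          (\<integral>\<^sup>+y. indicator ?B x * indicator ?B y * ennreal (?p * ?e x y) \<partial>?L)
         = (\<integral>\<^sup>+y. (ennreal ?p * indicator ?B x) * indicator ?B y \<partial>?L)" .
    qed
    also have "\<dots> = ennreal ?p * ennreal v * ennreal v"
      by (simp add: nn_integral_cmult nn_integral_multc meas_B)
    also have "\<dots> = ennreal (m\<^sup>2)"
      using v0 by (simp add: m_def power2_eq_square field_simps flip: ennreal_mult)
    finally show ?thesis .
  qed
  \<comment> \<open>Reproducing property: for fixed \<open>x\<close> in the ball, \<open>y\<close>
    ranges over the whole space, and the Gaussian mass \<open>pi ^ CARD('d)\<close> cancels one of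
    the two normalising factors.\<close>
  have FG: "F + G = ennreal m"
  proof -
    have "F + G = (\<integral>\<^sup>+x. (\<integral>\<^sup>+y. indicator ?B x * indicator ?B y * ennreal (?p * ?e x y) \<partial>?L) +
          (\<integral>\<^sup>+y. indicator ?B x * indicator (- ?B) y * ennreal (?p * ?e x y) \<partial>?L) \<partial>?L)"
      unfolding F_def G_def by (rule nn_integral_add[symmetric]) measurable
    also have "\<dots> = (\<integral>\<^sup>+x. indicator ?B x * ennreal (1 / pi ^ ?D) \<partial>?L)"
    proof (rule nn_integral_cong)
      fix x
      have "(\<integral>\<^sup>+y. indicator ?B x * indicator ?B y * ennreal (?p * ?e x y) \<partial>?L) +
          (\<integral>\<^sup>+y. indicator ?B x * indicator (- ?B) y * ennreal (?p * ?e x y) \<partial>?L)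
         = (\<integral>\<^sup>+y. indicator ?B x * indicator ?B y * ennreal (?p * ?e x y) +
                 indicator ?B x * indicator (- ?B) y * ennreal (?p * ?e x y) \<partial>?L)"
        by (rule nn_integral_add[symmetric]) measurable
      also have "\<dots> = (\<integral>\<^sup>+y. indicator ?B x * ennreal (?p * ?e x y) \<partial>?L)"
        by (intro nn_integral_cong) (auto simp: indicator_def)
      also have "\<dots> = (\<integral>\<^sup>+y. indicator ?B x * ennreal (?p * ?e x (x + y)) \<partial>?L)"
        by (subst nn_integral_lborel_shift[of _ x, symmetric]) simp_all
      also have "\<dots> = indicator ?B x * ennreal ?p * (\<integral>\<^sup>+y. ennreal (exp (-(norm y)\<^sup>2)) \<partial>?L)"
        by (subst nn_integral_cmult[symmetric])
           (auto simp: indicator_def simp flip: ennreal_mult intro!: nn_integral_cong)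
      also have "(\<integral>\<^sup>+y. ennreal (exp (-(norm y)\<^sup>2)) \<partial>?L) = ennreal (pi ^ ?D)"
        using has_bochner_integral_gaussian[OF dim]
        by (subst nn_integral_eq_integral) (auto simp: has_bochner_integral_iff)
      also have "indicator ?B x * ennreal ?p * ennreal (pi ^ ?D) = indicator ?B x * ennreal (1 / pi ^ ?D)"
        by (simp add: mult.assoc flip: ennreal_mult)
      finally show "(\<integral>\<^sup>+y. indicator ?B x * indicator ?B y * ennreal (?p * ?e x y) \<partial>?L) +
          (\<integral>\<^sup>+y. indicator ?B x * indicator (- ?B) y * ennreal (?p * ?e x y) \<partial>?L)
         = indicator ?B x * ennreal (1 / pi ^ ?D)" .
    qed
    also have "\<dots> = ennreal v * ennreal (1 / pi ^ ?D)"
      by (subst nn_integral_multc) (auto simp: meas_B)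
    also have "\<dots> = ennreal m" using v0 by (simp add: m_def flip: ennreal_mult)
    finally show ?thesis .
  qed
  define I where "I = (\<integral>\<^sup>+z. ennreal (exp (-(norm z)\<^sup>2) * slab_fraction (2 * ?D) (norm z / (2 * R))) \<partial>?L)"
  have G: "G = ennreal (m / pi ^ ?D) * I"
  proof -
    have "G = (\<integral>\<^sup>+x. ennreal ?p * (\<integral>\<^sup>+y. indicator ?B x * indicator (- ?B) y * ennreal (?e x y) \<partial>?L) \<partial>?L)"
      unfolding G_def
    proof (rule nn_integral_cong)
      fix x
      show "(\<integral>\<^sup>+y. indicator ?B x * indicator (- ?B) y * ennreal (?p * ?e x y) \<partial>?L)
        = ennreal ?p * (\<integral>\<^sup>+y. indicator ?B x * indicator (- ?B) y * ennreal (?e x y) \<partial>?L)"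
        by (subst nn_integral_cmult[symmetric]) 
           (auto simp: indicator_def simp flip: ennreal_mult intro!: nn_integral_cong)
    qed
    also have "\<dots> = ennreal ?p * (\<integral>\<^sup>+x. (\<integral>\<^sup>+y. indicator ?B x * indicator (- ?B) y * ennreal (?e x y) \<partial>?L) \<partial>?L)"
      by (rule nn_integral_cmult) measurable
    also have "\<dots> = ennreal ?p * (ennreal v * I)"
      unfolding nn_integral_gaussian_across_sphere[OF R dim2] dim v_def I_def by simp
    also have "\<dots> = ennreal (m / pi ^ ?D) * I"
      using v0 by (simp add: m_def mult.assoc[symmetric] flip: ennreal_mult)
    finally show ?thesis .
  qed
  obtain f g a where fga: "F = ennreal f" "G = ennreal g" "A = ennreal a" "f \<ge> 0" "g \<ge> 0" "a \<ge> 0"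
    using AF FG by (cases F; cases G; cases A) auto
  have af: "a + f = m\<^sup>2" using AF fga m0 by (simp flip: ennreal_plus)
  have fg: "f + g = m" using FG fga m0 by (simp flip: ennreal_plus)
  have hN: "has_bochner_integral M N m"
    by (rule has_bochner_integral_nn_integral) (use EN m0 N in \<open>auto simp: N_nonneg\<close>)
  have hNN: "has_bochner_integral M (\<lambda>\<omega>. N \<omega> * (N \<omega> - 1)) a"
  proof (rule has_bochner_integral_nn_integral)
    show "AE \<omega> in M. 0 \<le> N \<omega> * (N \<omega> - 1)"
      by (rule AE_I2) (auto simp: N_def mult_nonneg_nonneg zero_le_mult_iff)
  qed (use EN2 fga N in auto)
  have hN2: "has_bochner_integral M (\<lambda>\<omega>. (N \<omega>)\<^sup>2) (a + m)"
    using has_bochner_integral_add[OF hNN hN] by (simp add: algebra_simps power2_eq_square)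
  have E: "expectation N = m" using hN by (simp add: has_bochner_integral_iff)
  have "variance N = expectation (\<lambda>\<omega>. (N \<omega>)\<^sup>2) - (expectation N)\<^sup>2"
    using hN hN2 by (intro variance_eq) (auto simp: has_bochner_integral_iff)
  also have "\<dots> = g"
    using hN hN2 af fg by (simp add: has_bochner_integral_iff)
  finally have V: "variance N = g" .
  show "expectation N = R ^ (2 * ?D) / fact ?D"
    unfolding E m_def v_def unit_ball_vol_even by simp
  have [measurable]: "slab_fraction (2 * ?D) \<in> borel_measurable borel" by simp
  \<comment> \<open>A divergent integral would give 0 on both sides, so integrability can be left to
    the expansion.\<close>
  have LI: "(LINT z|?L. exp (-(norm z)\<^sup>2) * slab_fraction (2 * ?D) (norm z / (2 * R))) = enn2real I"
    unfolding I_def by (rule integral_eq_nn_integral) (auto simp: slab_fraction_nonneg)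
  have "g = enn2real (ennreal (m / pi ^ ?D) * I)"
    using G fga by (metis enn2real_ennreal)
  also have "\<dots> = m / pi ^ ?D * enn2real I"
    using m0 by (simp add: enn2real_mult)
  finally have "variance N = m / pi ^ ?D * enn2real I" unfolding V .
  then show "variance N = expectation N / pi ^ ?D *
     (LINT z|?L. exp (-(norm z)\<^sup>2) * slab_fraction (2 * ?D) (norm z / (2 * R)))"
    by (simp only: E LI)
qed

section \<open>Asymptotic expansion\<close>

text \<open>The tail is z^(N+1) times a power series. Convergence of the binomial series at 1/2
  gives absolute convergence at 1/4, and the sum of absolute values there serves as the constant for
  all smaller |z|.\<close>

lemma gbinomial_tail_bound:
  fixes a :: real
  obtains C where "C \<ge> 0"
    "\<And>z. \<bar>z\<bar> \<le> 1/4 \<Longrightarrow> \<bar>(1 + z) powr a - (\<Sum>k\<le>N. (a gchoose k) * z ^ k)\<bar> \<le> C * \<bar>z\<bar> ^ (N + 1)"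
proof -
  let ?g = "\<lambda>k. \<bar>a gchoose (k + Suc N)\<bar> * (1/4) ^ k"
  have "summable (\<lambda>k. (a gchoose k) * (1/2) ^ k)"
    using gen_binomial_real[of "1/2" a] by (auto simp: sums_iff)
  then have "summable (\<lambda>k. norm ((a gchoose k) * (1/4) ^ k))"
    by (rule powser_insidea) simp
  then have "summable (\<lambda>k. norm ((a gchoose (k + Suc N)) * (1/4) ^ (k + Suc N)))"
    by (subst summable_iff_shift)
  then have "summable (\<lambda>k. 4 ^ Suc N * norm ((a gchoose (k + Suc N)) * (1/4) ^ (k + Suc N)))"
    by (rule summable_mult)
  also have "(\<lambda>k. 4 ^ Suc N * norm ((a gchoose (k + Suc N)) * (1/4) ^ (k + Suc N))) = ?g"
    by (auto simp: fun_eq_iff abs_mult power_add field_simps power_one_over)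
  finally have sg: "summable ?g" .
  show ?thesis
  proof (rule that[of "suminf ?g"])
    show "suminf ?g \<ge> 0" by (rule suminf_nonneg[OF sg]) simp
    fix z :: real assume z: "\<bar>z\<bar> \<le> 1/4"
    let ?f = "\<lambda>k. (a gchoose k) * z ^ k"
    have s: "?f sums (1 + z) powr a" using z by (intro gen_binomial_real) simp
    then have sf: "summable ?f" by (simp add: sums_iff)
    have "(1 + z) powr a - (\<Sum>k\<le>N. ?f k) = (\<Sum>k. ?f (k + Suc N))"
      using s suminf_minus_initial_segment[OF sf, of "Suc N"] by (simp add: sums_iff lessThan_Suc_atMost)
    also have "\<dots> = (\<Sum>k. z ^ Suc N * ((a gchoose (k + Suc N)) * z ^ k))"
      by (simp add: power_add mult_ac)
    finally have eq: "(1 + z) powr a - (\<Sum>k\<le>N. ?f k) = (\<Sum>k. z ^ Suc N * ((a gchoose (k + Suc N)) * z ^ k))" .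
    have bd: "norm ((a gchoose (k + Suc N)) * z ^ k) \<le> ?g k" for k
      using power_mono[OF z, of k] by (auto simp: abs_mult power_abs intro!: mult_left_mono)
    have sh: "summable (\<lambda>k. (a gchoose (k + Suc N)) * z ^ k)"
      by (rule summable_comparison_test'[OF sg]) (rule bd)
    have "norm (\<Sum>k. (a gchoose (k + Suc N)) * z ^ k) \<le> suminf ?g"
      by (rule norm_suminf_le) (use bd sg in auto)
    then show "\<bar>(1 + z) powr a - (\<Sum>k\<le>N. ?f k)\<bar> \<le> suminf ?g * \<bar>z\<bar> ^ (N + 1)"
      unfolding eq suminf_mult[OF sh] by (auto simp: abs_mult power_abs mult.commute simp del: power_Suc intro!: mult_left_mono)
  qed
qed

text \<open>The remainder bound holds for all real \<open>t\<close>, including \<open>|t| > 1\<close> where \<^const>\<open>ball_profile\<close> vanishes;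
  no tail estimate for the Gaussian is therefore needed later.\<close>
lemma ball_profile_expansion:
  assumes D: "D > 0"
  obtains C where "C \<ge> 0"
    "\<And>t. \<bar>ball_profile (2 * D) t - (\<Sum>k\<le>N. (-1) ^ k * ((real D - 1/2) gchoose k) * t ^ (2 * k))\<bar> \<le> C * t ^ (2 * N + 2)"
proof -
  let ?a = "real D - 1/2"
  let ?c = "\<lambda>k. (-1) ^ k * (?a gchoose k)"
  obtain C0 where C0: "C0 \<ge> 0"
    "\<And>z. \<bar>z\<bar> \<le> 1/4 \<Longrightarrow> \<bar>(1 + z) powr ?a - (\<Sum>k\<le>N. (?a gchoose k) * z ^ k)\<bar> \<le> C0 * \<bar>z\<bar> ^ (N + 1)"
    using gbinomial_tail_bound by blast
  \<comment> \<open>Constant for t^2 > 1/4: there 1 is below 4 t^2, so the profile (at most 1) and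
    every power t^(2k) with k up to \<open>N\<close> are bounded by (4 t^2)^(N+1).\<close>
  define C1 where "C1 = (1 + (\<Sum>k\<le>N. \<bar>?a gchoose k\<bar>)) * 4 ^ (N + 1)"
  have C1: "C1 \<ge> 0" by (auto simp: C1_def intro!: mult_nonneg_nonneg add_nonneg_nonneg sum_nonneg)
  show ?thesis
  proof (rule that[of "C0 + C1"])
    show "C0 + C1 \<ge> 0" using C0 C1 by simp
    fix t :: real
    have t2: "t ^ (2 * N + 2) = (t\<^sup>2) ^ (N + 1)"
      using power_mult[of t 2 "N + 1"] by simp
    have pos: "(t\<^sup>2) ^ (N + 1) \<ge> 0" by simp
    have "\<bar>ball_profile (2 * D) t - (\<Sum>k\<le>N. ?c k * t ^ (2 * k))\<bar> \<le> max C0 C1 * (t\<^sup>2) ^ (N + 1)"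
    proof (cases "t\<^sup>2 \<le> 1/4")
      case True
      have "ball_profile (2 * D) t = (1 + - t\<^sup>2) powr ?a"
      proof -
        have "sqrt (1 - t\<^sup>2) = (1 - t\<^sup>2) powr (1/2)"
          using True by (simp add: powr_half_sqrt)
        then have "ball_profile (2 * D) t = ((1 - t\<^sup>2) powr (1/2)) powr real (2 * D - 1)"
          using True by (simp add: ball_profile_def powr_realpow)
        also have "\<dots> = (1 + - t\<^sup>2) powr ?a"
          using D by (simp add: powr_powr of_nat_diff field_simps)
        finally show ?thesis .
      qed
      moreover have "(?a gchoose k) * (- t\<^sup>2) ^ k = ?c k * t ^ (2 * k)" for k
        by (subst power_minus) (simp add: power_mult)
      ultimately have "\<bar>ball_profile (2 * D) t - (\<Sum>k\<le>N. ?c k * t ^ (2 * k))\<bar> \<le> C0 * \<bar>- t\<^sup>2\<bar> ^ (N + 1)"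
        using C0(2)[of "- t\<^sup>2"] True by (simp only:) simp
      also have "\<dots> = C0 * (t\<^sup>2) ^ (N + 1)" by simp
      also have "\<dots> \<le> max C0 C1 * (t\<^sup>2) ^ (N + 1)" by (intro mult_right_mono) auto
      finally show ?thesis .
    next
      case False
      then have ge: "1 \<le> 4 * t\<^sup>2" by simp
      have "\<bar>ball_profile (2 * D) t\<bar> \<le> 1"
        by (auto simp: ball_profile_def power_abs intro!: power_le_one)
      moreover have "\<bar>?c k * t ^ (2 * k)\<bar> \<le> \<bar>?a gchoose k\<bar> * (4 * t\<^sup>2) ^ (N + 1)" if "k \<le> N" for k
      proof -
        have "\<bar>?c k * t ^ (2 * k)\<bar> = \<bar>?a gchoose k\<bar> * (t\<^sup>2) ^ k"
          by (simp add: abs_mult power_mult power_abs)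
        also have "(t\<^sup>2) ^ k \<le> (4 * t\<^sup>2) ^ k" by (intro power_mono) auto
        also have "\<dots> \<le> (4 * t\<^sup>2) ^ (N + 1)" using ge that by (intro power_increasing) auto
        finally show ?thesis by (simp add: mult_left_mono)
      qed
      then have "\<bar>\<Sum>k\<le>N. ?c k * t ^ (2 * k)\<bar> \<le> (\<Sum>k\<le>N. \<bar>?a gchoose k\<bar> * (4 * t\<^sup>2) ^ (N + 1))"
        by (intro order_trans[OF sum_abs] sum_mono) auto
      moreover have "1 \<le> (4 * t\<^sup>2) ^ (N + 1)" using ge by (rule one_le_power)
      ultimately have "\<bar>ball_profile (2 * D) t - (\<Sum>k\<le>N. ?c k * t ^ (2 * k))\<bar> 
         \<le> (4 * t\<^sup>2) ^ (N + 1) + (\<Sum>k\<le>N. \<bar>?a gchoose k\<bar>) * (4 * t\<^sup>2) ^ (N + 1)"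
        unfolding sum_distrib_right by linarith
      also have "\<dots> = C1 * (t\<^sup>2) ^ (N + 1)"
        by (simp only: C1_def power_mult_distrib) (simp add: algebra_simps)
      also have "\<dots> \<le> max C0 C1 * (t\<^sup>2) ^ (N + 1)" by (intro mult_right_mono) auto
      finally show ?thesis .
    qed
    also have "\<dots> \<le> (C0 + C1) * (t\<^sup>2) ^ (N + 1)"
      using C0 C1 by (intro mult_right_mono) auto
    finally show "\<bar>ball_profile (2 * D) t - (\<Sum>k\<le>N. (-1) ^ k * (?a gchoose k) * t ^ (2 * k))\<bar> \<le> (C0 + C1) * t ^ (2 * N + 2)"
      unfolding t2 .
  qed
qed

text \<open>Taylor coefficient of s^(2k+1) in \<open>slab_fraction (2 * D) s\<close> at 0, from
  integrating the binomial series of the profile term by term.\<close>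

definition slab_coeff :: "nat \<Rightarrow> nat \<Rightarrow> real" where
  "slab_coeff D k = unit_ball_vol (real (2 * D - 1)) / unit_ball_vol (real (2 * D)) *
     (2 * (-1) ^ k * ((real D - 1/2) gchoose k) / real (2 * k + 1))"

lemma has_integral_even_power:
  assumes "s \<ge> 0"
  shows "((\<lambda>t::real. t ^ (2 * k)) has_integral 2 * s ^ (2 * k + 1) / real (2 * k + 1)) {-s..s}"
proof -
  have "((\<lambda>t::real. t ^ (2 * k)) has_integral s ^ (2 * k + 1) / real (2 * k + 1) - (-s) ^ (2 * k + 1) / real (2 * k + 1)) {-s..s}"
  proof (rule fundamental_theorem_of_calculus)
    fix x :: real
    have "((\<lambda>t. t ^ (2 * k + 1) / real (2 * k + 1)) has_real_derivative x ^ (2 * k)) (at x within {-s..s})"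
      using DERIV_cdivide[OF DERIV_pow[of "2 * k + 1" x], of "real (2 * k + 1)"] by simp
    then show "((\<lambda>t. t ^ (2 * k + 1) / real (2 * k + 1)) has_vector_derivative x ^ (2 * k)) (at x within {-s..s})"
      by (simp add: has_real_derivative_iff_has_vector_derivative)
  qed (use assms in auto)
  then show ?thesis by (simp add: power_minus_odd)
qed

text \<open>The profile bound is integrated over {-s..s}. Since it holds on the whole line, the
  result holds for arbitrarily wide slabs, as needed under a Gaussian average.\<close>

lemma slab_fraction_expansion:
  assumes D: "D > 0"
  obtains C where "C \<ge> 0"
    "\<And>s. s \<ge> 0 \<Longrightarrow> \<bar>slab_fraction (2 * D) s - (\<Sum>k\<le>N. slab_coeff D k * s ^ (2 * k + 1))\<bar> \<le> C * s ^ (2 * N + 3)"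
proof -
  let ?c = "\<lambda>k. (-1) ^ k * ((real D - 1/2) gchoose k)"
  let ?q = "\<lambda>t. \<Sum>k\<le>N. ?c k * t ^ (2 * k)"
  let ?v = "unit_ball_vol (real (2 * D - 1)) / unit_ball_vol (real (2 * D))"
  obtain C where C: "C \<ge> 0" "\<And>t. \<bar>ball_profile (2 * D) t - ?q t\<bar> \<le> C * t ^ (2 * N + 2)"
    using ball_profile_expansion[OF D] by blast
  have v: "?v \<ge> 0" by (intro divide_nonneg_nonneg) auto
  show ?thesis
  proof (rule that[of "?v * (C * (2 / real (2 * N + 3)))"])
    show "0 \<le> ?v * (C * (2 / real (2 * N + 3)))" using v C(1) by (intro mult_nonneg_nonneg) auto
    fix s :: real assume s: "s \<ge> 0"
    have q: "(?q has_integral (\<Sum>k\<le>N. ?c k * (2 * s ^ (2 * k + 1) / real (2 * k + 1)))) {-s..s}"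
      by (intro has_integral_sum has_integral_mult_right has_integral_even_power s) auto
    have p: "ball_profile (2 * D) integrable_on {-s..s}"
      by (intro integrable_continuous_interval continuous_intros)
    have b: "((\<lambda>t. C * t ^ (2 * N + 2)) has_integral C * (2 * s ^ (2 * N + 3) / real (2 * N + 3))) {-s..s}"
      using has_integral_mult_right[OF has_integral_even_power[OF s, of "N + 1"], of C]
      by (simp add: eval_nat_numeral algebra_simps)
    have "\<bar>integral {-s..s} (\<lambda>t. ball_profile (2 * D) t - ?q t)\<bar> \<le> integral {-s..s} (\<lambda>t. C * t ^ (2 * N + 2))"
      unfolding real_norm_def[symmetric]
      by (rule integral_norm_bound_integral) (use p q b C(2) in \<open>auto intro!: integrable_diff\<close>)
    also have "integral {-s..s} (\<lambda>t. ball_profile (2 * D) t - ?q t)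
        = integral {-s..s} (ball_profile (2 * D)) - (\<Sum>k\<le>N. ?c k * (2 * s ^ (2 * k + 1) / real (2 * k + 1)))"
      using p q by (subst integral_diff) (auto simp: integral_unique)
    also have "integral {-s..s} (\<lambda>t. C * t ^ (2 * N + 2)) = C * (2 * s ^ (2 * N + 3) / real (2 * N + 3))"
      using b by (rule integral_unique)
    finally have *: "\<bar>integral {-s..s} (ball_profile (2 * D)) - (\<Sum>k\<le>N. ?c k * (2 * s ^ (2 * k + 1) / real (2 * k + 1)))\<bar>
       \<le> C * (2 * s ^ (2 * N + 3) / real (2 * N + 3))" .
    have "slab_fraction (2 * D) s - (\<Sum>k\<le>N. slab_coeff D k * s ^ (2 * k + 1))
       = ?v * (integral {-s..s} (ball_profile (2 * D)) - (\<Sum>k\<le>N. ?c k * (2 * s ^ (2 * k + 1) / real (2 * k + 1))))"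
      unfolding slab_fraction_def slab_coeff_def right_diff_distrib sum_distrib_left
      by (simp add: mult_ac)
    also have "\<bar>\<dots>\<bar> \<le> ?v * (C * (2 * s ^ (2 * N + 3) / real (2 * N + 3)))"
      unfolding abs_mult abs_of_nonneg[OF v] using * v by (rule mult_left_mono)
    finally show "\<bar>slab_fraction (2 * D) s - (\<Sum>k\<le>N. slab_coeff D k * s ^ (2 * k + 1))\<bar>
       \<le> ?v * (C * (2 / real (2 * N + 3))) * s ^ (2 * N + 3)"
      by simp
  qed
qed

section \<open>Gaussian moments and the coefficients of the expansion\<close>

lemma pochhammer_half: "fact (2 * m) / (2 ^ (2 * m) * fact m) = (pochhammer (1/2) m :: real)"
  by (subst fact_double) simp

text \<open>In even dimension an odd power of the norm leads to the even radial exponent 2 (D + k).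
  Its half-line moment is Gamma(D + k + 1/2) / 2, which is where the square root of pi in the
  theorem comes from.\<close>

lemma has_bochner_integral_gaussian_odd_moment:
  assumes "DIM('a::euclidean_space) = 2 * D"
  shows "has_bochner_integral lborel (\<lambda>x::'a. exp (-(norm x)\<^sup>2) * norm x ^ (2 * k + 1))
     (real D * unit_ball_vol (real (2 * D)) * sqrt pi * pochhammer (1/2) (D + k))"
proof -
  have "2 * (D + k) = 2 * k + 1 + (DIM('a) - 1)" using assms DIM_positive[where 'a='a] by simp
  then have "has_bochner_integral lborel (\<lambda>x::'a. exp (-(norm x)\<^sup>2) * norm x ^ (2 * k + 1))
      (DIM('a) * unit_ball_vol DIM('a) * (sqrt pi / 2 * pochhammer (1/2) (D + k)))"
    using gaussian_moment_even_pos[of "D + k"] unfolding pochhammer_half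
    by (intro has_bochner_integral_radial_gaussian) metis
  then show ?thesis by (simp add: assms mult_ac)
qed

text \<open>Each factor is a difference of squares. The factors 2D - (2l - 1) form the falling
  factorial of D - 1/2, the factors 2D + (2l - 1) the rising factorial of D + 1/2, each up to
  2^k.\<close>

lemma alpha_coef_eq: "alpha_coef k D = 4 ^ k * fact k * ((real D - 1/2) gchoose k) * pochhammer (real D + 1/2) k"
proof (induction k)
  case 0
  show ?case by (simp add: alpha_coef_def)
next
  case (Suc k)
  have *: "fact (Suc k) * ((real D - 1/2) gchoose Suc k) = (real D - 1/2 - k) * (fact k * ((real D - 1/2) gchoose k))"
    by (simp add: gbinomial_prod_rev atLeast0_lessThan_Suc)
  have "4 ^ Suc k * fact (Suc k) * ((real D - 1/2) gchoose Suc k) * pochhammer (real D + 1/2) (Suc k)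
     = 4 * 4 ^ k * (fact (Suc k) * ((real D - 1/2) gchoose Suc k)) * (pochhammer (real D + 1/2) k * (real D + 1/2 + k))"
    by (simp only: pochhammer_Suc power_Suc mult.assoc)
  also have "\<dots> = 4 * (real D - 1/2 - k) * (real D + 1/2 + k) * alpha_coef k D"
    unfolding * Suc.IH by (simp only: mult_ac)
  also have "4 * (real D - 1/2 - k) * (real D + 1/2 + k) = 4 * (real D)\<^sup>2 - (2 * real (Suc k) - 1)\<^sup>2"
    by (simp add: power2_eq_square algebra_simps)
  finally show ?case by (simp add: alpha_coef_def)
qed

text \<open>Coefficient times moment: 2^(2k+1) comes from s = |z| / (2R) and pi^D from the
  normalisation. The volume in dimension 2D cancels, and the volume in dimension 2D - 1 removes the
  factor (1/2)_D from (1/2)_(D+k), leaving the rising factorial that \<open>alpha_coef_eq\<close>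
  asks for.\<close>

lemma slab_coeff_moment:
  assumes D: "D > 0"
  shows "slab_coeff D k * (real D * unit_ball_vol (real (2 * D)) * sqrt pi * pochhammer (1/2) (D + k)) / (2 ^ (2 * k + 1) * pi ^ D)
    = real D / sqrt pi * ((-1) ^ k * alpha_coef k D / (real (2 * k + 1) * fact k * 2 ^ (4 * k)))"
proof -
  let ?g = "(real D - 1/2) gchoose k" and ?P = "pochhammer (real D + 1/2) k" and ?h = "pochhammer (1/2 :: real) D"
  have h: "?h \<noteq> 0" using pochhammer_pos[of "1/2::real" D] by simp
  have odd: "2 * D - 1 = 2 * (D - 1) + 1" using D by simp
  have vol: "unit_ball_vol (real (2 * D - 1)) = pi ^ (D - 1) / ?h"
    unfolding odd unit_ball_vol_odd' using D by simp
  have poch: "pochhammer (1/2) (D + k) = ?h * ?P"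
    using pochhammer_product'[of "1/2::real" D k] by (simp add: add.commute)
  have pi_D: "pi ^ D = pi ^ (D - 1) * (sqrt pi * sqrt pi)"
    using D by (simp add: power_eq_if)
  have u: "unit_ball_vol (real (2 * D)) \<noteq> 0"
    using unit_ball_vol_pos[of "real (2 * D)"] by (simp del: unit_ball_vol_pos)
  have two: "(2::real) ^ (4 * k) = 4 ^ k * 4 ^ k" "(2::real) ^ (2 * k + 1) = 2 * 4 ^ k"
    by (simp_all add: power_mult flip: power_mult_distrib)
  \<comment> \<open>The cancellation is done over arbitrary reals, with \<open>p\<close> for
    pi^(D-1), \<open>q\<close> for the root of pi, \<open>h'\<close> for (1/2)_D and
    \<open>Q\<close> for 4^k, so that simplification cannot unfold the concrete terms.\<close>
  have "p / h' / u * (2 * e * g / m) * (d * u * q * (h' * P)) / (2 * Q * (p * (q * q)))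
      = d / q * (e * (Q * f * g * P) / (m * f * (Q * Q)))"
    if "h' \<noteq> 0" "u \<noteq> 0" "p \<noteq> 0" "q \<noteq> 0" "m \<noteq> 0" "f \<noteq> 0" "Q \<noteq> 0" for p h' u e g m d q P Q f :: real
    using that by (simp add: field_simps)
  note cancel = this
  show ?thesis
    unfolding slab_coeff_def alpha_coef_eq vol poch pi_D two
    by (rule cancel) (use h u in auto)
qed

lemma gaussian_slab_expansion:
  assumes dim: "DIM('a::euclidean_space) = 2 * D"
  obtains C where "\<And>R. R > 0 \<Longrightarrow>
    \<bar>(LINT z|(lborel :: 'a measure). exp (-(norm z)\<^sup>2) * slab_fraction (2 * D) (norm z / (2 * R))) / pi ^ D -
     (\<Sum>k\<le>N. real D / sqrt pi * ((-1) ^ k * alpha_coef k D / (real (2 * k + 1) * fact k * 2 ^ (4 * k))) / R ^ (2 * k + 1))\<bar>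
     \<le> C / R ^ (2 * N + 3)"
proof -
  have D: "D > 0" using dim DIM_positive[where 'a='a] by linarith
  obtain C where C: "C \<ge> 0" "\<And>s. s \<ge> 0 \<Longrightarrow>
      \<bar>slab_fraction (2 * D) s - (\<Sum>k\<le>N. slab_coeff D k * s ^ (2 * k + 1))\<bar> \<le> C * s ^ (2 * N + 3)"
    using slab_fraction_expansion[OF D] by blast
  define mom where "mom k = real D * unit_ball_vol (real (2 * D)) * sqrt pi * pochhammer (1/2) (D + k)" for k
  have mom: "has_bochner_integral lborel (\<lambda>x::'a. exp (-(norm x)\<^sup>2) * norm x ^ (2 * k + 1)) (mom k)" for k
    unfolding mom_def by (rule has_bochner_integral_gaussian_odd_moment[OF dim])
  have [measurable]: "slab_fraction (2 * D) \<in> borel_measurable borel" using D by simp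
  \<comment> \<open>The remainder C s^(2N+3) at s = |z| / (2R) is averaged against the moment of
    order 2N + 3 = 2 (N + 1) + 1, whence \<open>mom (N + 1)\<close> and the power of 2.\<close>
  show ?thesis
  proof (rule that[of "C * mom (N + 1) / 2 ^ (2 * N + 3) / pi ^ D"])
    fix R :: real assume R: "R > 0"
    let ?f = "\<lambda>z::'a. exp (-(norm z)\<^sup>2) * slab_fraction (2 * D) (norm z / (2 * R))"
    let ?q = "\<lambda>z::'a. \<Sum>k\<le>N. slab_coeff D k / (2 * R) ^ (2 * k + 1) * (exp (-(norm z)\<^sup>2) * norm z ^ (2 * k + 1))"
    let ?r = "\<lambda>z::'a. C / (2 * R) ^ (2 * N + 3) * (exp (-(norm z)\<^sup>2) * norm z ^ (2 * (N + 1) + 1))"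
    have q: "has_bochner_integral lborel ?q (\<Sum>k\<le>N. slab_coeff D k / (2 * R) ^ (2 * k + 1) * mom k)"
      by (intro has_bochner_integral_sum has_bochner_integral_mult_right mom)
    have r: "has_bochner_integral lborel ?r (C / (2 * R) ^ (2 * N + 3) * mom (N + 1))"
      by (intro has_bochner_integral_mult_right mom)
    have bound: "\<bar>?f z - ?q z\<bar> \<le> ?r z" for z
    proof -
      have "?f z - ?q z = exp (-(norm z)\<^sup>2) * (slab_fraction (2 * D) (norm z / (2 * R)) -
          (\<Sum>k\<le>N. slab_coeff D k * (norm z / (2 * R)) ^ (2 * k + 1)))"
        unfolding right_diff_distrib sum_distrib_left power_divide by (simp add: mult_ac)
      also have "\<bar>\<dots>\<bar> \<le> exp (-(norm z)\<^sup>2) * (C * (norm z / (2 * R)) ^ (2 * N + 3))"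
        unfolding abs_mult using C(2)[of "norm z / (2 * R)"] R by (intro mult_mono) auto
      also have "\<dots> = ?r z" by (simp add: power_divide eval_nat_numeral)
      finally show ?thesis .
    qed
    have ri: "integrable lborel ?r" using r by (simp only: has_bochner_integral_iff)
    \<comment> \<open>Integrability of \<open>?f\<close> is itself a consequence of the remainder
      bound: the difference is dominated by \<open>?r\<close>, and \<open>?q\<close> is a sum of
      moments.\<close>
    have id: "integrable lborel (\<lambda>z. ?f z - ?q z)"
    proof (rule Bochner_Integration.integrable_bound)
      show "integrable lborel ?r" by (rule ri)
      show "(\<lambda>z. ?f z - ?q z) \<in> borel_measurable lborel" by measurable
      show "AE z in lborel. norm (?f z - ?q z) \<le> norm (?r z)"
        unfolding real_norm_def by (intro AE_I2 order_trans[OF bound abs_ge_self])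
    qed
    have "integrable lborel ?q" using q by (simp add: has_bochner_integral_iff)
    from Bochner_Integration.integrable_add[OF id this] have f: "integrable lborel ?f" by simp
    let ?S = "\<Sum>k\<le>N. slab_coeff D k / (2 * R) ^ (2 * k + 1) * mom k"
    let ?T = "\<Sum>k\<le>N. real D / sqrt pi * ((-1) ^ k * alpha_coef k D / (real (2 * k + 1) * fact k * 2 ^ (4 * k))) / R ^ (2 * k + 1)"
    have int_diff: "(LINT z|lborel. ?f z - ?q z) = (LINT z|lborel. ?f z) - ?S"
      using Bochner_Integration.integral_diff[OF f, of ?q] q by (simp only: has_bochner_integral_iff)
    have int_r: "(LINT z|lborel. ?r z) = C / (2 * R) ^ (2 * N + 3) * mom (N + 1)"
      using r by (simp only: has_bochner_integral_iff)
    have abs_le: "\<bar>LINT z|lborel. ?f z - ?q z\<bar> \<le> (LINT z|lborel. \<bar>?f z - ?q z\<bar>)"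
      by (rule integral_abs_bound)
    have "(LINT z|lborel. \<bar>?f z - ?q z\<bar>) \<le> (LINT z|lborel. ?r z)"
      by (rule Bochner_Integration.integral_mono, rule integrable_abs, rule id, rule ri, rule bound)
    then have "\<bar>(LINT z|lborel. ?f z) - ?S\<bar> \<le> C / (2 * R) ^ (2 * N + 3) * mom (N + 1)"
      using abs_le unfolding int_diff int_r by (rule order_trans[rotated])
    then have le: "\<bar>(LINT z|lborel. ?f z) - ?S\<bar> / pi ^ D \<le> C / (2 * R) ^ (2 * N + 3) * mom (N + 1) / pi ^ D"
      by (rule divide_right_mono) simp
    have "slab_coeff D k / (2 * R) ^ (2 * k + 1) * mom k / pi ^ D
       = real D / sqrt pi * ((-1) ^ k * alpha_coef k D / (real (2 * k + 1) * fact k * 2 ^ (4 * k))) / R ^ (2 * k + 1)" for k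
      unfolding slab_coeff_moment[OF D, symmetric] mom_def[symmetric] power_mult_distrib by (simp add: mult_ac)
    then have S: "?S / pi ^ D = ?T"
      unfolding sum_divide_distrib by (intro sum.cong) simp_all
    have "\<bar>(LINT z|lborel. ?f z) / pi ^ D - ?T\<bar> = \<bar>(LINT z|lborel. ?f z) - ?S\<bar> / pi ^ D"
      unfolding S[symmetric] diff_divide_distrib[symmetric] abs_divide by simp
    also note le
    also have "C / (2 * R) ^ (2 * N + 3) * mom (N + 1) / pi ^ D = C * mom (N + 1) / 2 ^ (2 * N + 3) / pi ^ D / R ^ (2 * N + 3)"
      by (simp add: power_mult_distrib mult_ac)
    finally show "\<bar>(LINT z|lborel. ?f z) / pi ^ D - ?T\<bar>
       \<le> C * mom (N + 1) / 2 ^ (2 * N + 3) / pi ^ D / R ^ (2 * N + 3)" .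
  qed
qed

theorem theorem1p3:
  fixes M :: "'w measure" and Xi :: "'w \<Rightarrow> (complex ^ 'd) set"
  assumes "is_DPP M Xi heis_ref heis_kernel"
  defines "D \<equiv> CARD('d)"
  defines "E \<equiv> (\<lambda>R::real. prob_space.expectation M (\<lambda>\<omega>. real (card (Xi \<omega> \<inter> ball 0 R))))"
  defines "V \<equiv> (\<lambda>R::real. prob_space.variance M (\<lambda>\<omega>. real (card (Xi \<omega> \<inter> ball 0 R))))"
  shows "(\<exists>c1 c2. 0 < c1 \<and> c1 < c2 \<and>
            (\<forall>\<^sub>F R in at_top. c1 * R ^ (2 * D - 1) < V R \<and> V R < c2 * R ^ (2 * D - 1)))
     \<and> ((\<lambda>R. R * V R / E R) \<longlongrightarrow> real D / sqrt pi) at_top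
     \<and> (\<forall>N::nat. (\<lambda>R. V R / E R - real D / sqrt pi * R powr (-1) *
            (\<Sum>k\<le>N. (-1) ^ k * alpha_coef k D / (real (2 * k + 1) * fact k * 2 ^ (4 * k))
                       * R powr (- 2 * real k)))
          \<in> O[at_top](\<lambda>R. R powr (- (2 * real N + 3))))"
proof -
  have D: "D > 0" by (simp add: D_def)
  have dim: "DIM(complex ^ 'd) = 2 * D" by (simp add: D_def)
  let ?a = "\<lambda>k. (-1) ^ k * alpha_coef k D / (real (2 * k + 1) * fact k * 2 ^ (4 * k))"
  let ?I = "\<lambda>R. LINT z|(lborel :: (complex ^ 'd) measure). exp (-(norm z)\<^sup>2) * slab_fraction (2 * D) (norm z / (2 * R))"
  have E: "E R = R ^ (2 * D) / fact D" if "R > 0" for R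
    unfolding E_def D_def by (rule heis_expectation[OF assms(1) that])
  have V: "V R = E R / pi ^ D * ?I R" if "R > 0" for R
    unfolding E_def V_def D_def by (rule heis_variance[OF assms(1) that])
  have ratio: "V R / E R = ?I R / pi ^ D" if "R > 0" for R
    using that by (simp add: V E)
  have expansion: "\<exists>C. \<forall>R>0. \<bar>V R / E R - (\<Sum>k\<le>N. real D / sqrt pi * ?a k / R ^ (2 * k + 1))\<bar> \<le> C / R ^ (2 * N + 3)" for N
  proof -
    obtain C where "\<And>R. R > 0 \<Longrightarrow>
        \<bar>?I R / pi ^ D - (\<Sum>k\<le>N. real D / sqrt pi * ?a k / R ^ (2 * k + 1))\<bar> \<le> C / R ^ (2 * N + 3)"
      using gaussian_slab_expansion[OF dim, of N] by blast
    then show ?thesis by (intro exI[of _ C] allI impI) (simp only: ratio)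
  qed
  have lim: "((\<lambda>R. R * V R / E R) \<longlongrightarrow> real D / sqrt pi) at_top"
  proof -
    \<comment> \<open>The limit is the case N = 0 of the expansion, where \<open>alpha_coef\<close>
      is the empty product 1.\<close>
    obtain C where C: "\<And>R. R > 0 \<Longrightarrow> \<bar>V R / E R - real D / sqrt pi / R\<bar> \<le> C / R ^ 3"
      using expansion[of 0] by (auto simp: alpha_coef_def)
    have "((\<lambda>R. R * V R / E R - real D / sqrt pi) \<longlongrightarrow> 0) at_top"
    proof (rule Lim_null_comparison)
      show "((\<lambda>R::real. C / R\<^sup>2) \<longlongrightarrow> 0) at_top"
        by (intro real_tendsto_divide_at_top tendsto_const filterlim_pow_at_top filterlim_ident) auto
      show "\<forall>\<^sub>F R in at_top. norm (R * V R / E R - real D / sqrt pi) \<le> C / R\<^sup>2"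
        using eventually_gt_at_top[of 0]
      proof eventually_elim
        case (elim R)
        have "R * V R / E R - real D / sqrt pi = R * (V R / E R - real D / sqrt pi / R)"
          using elim by (simp add: right_diff_distrib)
        also have "norm \<dots> \<le> R * (C / R ^ 3)"
          using elim C[OF elim] by (simp add: abs_mult del: times_divide_eq_right)
        also have "\<dots> = C / R\<^sup>2" using elim by (simp add: eval_nat_numeral)
        finally show ?case .
      qed
    qed
    then show ?thesis by (simp add: LIM_zero_iff)
  qed
  \<comment> \<open>The mean is R^(2D) / D!, so \<open>L\<close> is the limit of V R / R^(2D-1). Any
    constants on either side of \<open>L\<close> give the strict Class I bounds; L/2 and 2L are
    taken.\<close>
  define L where "L = real D / sqrt pi / fact D"
  have L: "L > 0" using D by (simp add: L_def)
  have V_eq: "V R = R * V R / E R / fact D * R ^ (2 * D - 1)" if "R > 0" for R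
  proof -
    have "R ^ (2 * D) = R * R ^ (2 * D - 1)" using D by (simp add: power_eq_if)
    then show ?thesis using that by (simp add: E)
  qed
  have "((\<lambda>R. R * V R / E R / fact D) \<longlongrightarrow> L) at_top"
    unfolding L_def by (intro tendsto_divide lim tendsto_const) simp
  then have "\<forall>\<^sub>F R in at_top. L / 2 < R * V R / E R / fact D \<and> R * V R / E R / fact D < 2 * L"
    using L by (intro eventually_conj order_tendstoD) auto
  then have "\<forall>\<^sub>F R in at_top. L / 2 * R ^ (2 * D - 1) < V R \<and> V R < 2 * L * R ^ (2 * D - 1)"
    using eventually_gt_at_top[of 0]
  proof eventually_elim
    case (elim R)
    then have "R ^ (2 * D - 1) > 0" by simp
    with elim show ?case
      using V_eq[of R] mult_strict_right_mono[of "L / 2" "R * V R / E R / fact D" "R ^ (2 * D - 1)"]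
        mult_strict_right_mono[of "R * V R / E R / fact D" "2 * L" "R ^ (2 * D - 1)"] by simp
  qed
  moreover have "0 < L / 2" "L / 2 < 2 * L" using L by auto
  ultimately have class1: "\<exists>c1 c2. 0 < c1 \<and> c1 < c2 \<and>
            (\<forall>\<^sub>F R in at_top. c1 * R ^ (2 * D - 1) < V R \<and> V R < c2 * R ^ (2 * D - 1))"
    by blast
  have asym: "(\<lambda>R. V R / E R - real D / sqrt pi * R powr (-1) * (\<Sum>k\<le>N. ?a k * R powr (- 2 * real k)))
          \<in> O[at_top](\<lambda>R. R powr (- (2 * real N + 3)))" for N
  proof -
    obtain C where C: "\<And>R. R > 0 \<Longrightarrow>
        \<bar>V R / E R - (\<Sum>k\<le>N. real D / sqrt pi * ?a k / R ^ (2 * k + 1))\<bar> \<le> C / R ^ (2 * N + 3)"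
      using expansion[of N] by blast
    have pw: "R powr (- real j) = 1 / R ^ j" if "R > 0" for R :: real and j :: nat
      using that by (simp add: powr_minus powr_realpow divide_inverse)
    show ?thesis
    proof (rule bigoI[of _ C], use eventually_gt_at_top[of 0] in eventually_elim)
      case (elim R)
      have sum: "real D / sqrt pi * R powr (-1) * (\<Sum>k\<le>N. ?a k * R powr (- 2 * real k))
          = (\<Sum>k\<le>N. real D / sqrt pi * ?a k / R ^ (2 * k + 1))"
        unfolding sum_distrib_left
      proof (rule sum.cong)
        fix k
        have "R powr (-1) * R powr (- 2 * real k) = 1 / R ^ (2 * k + 1)"
        proof -
          have "-1 + - 2 * real k = - real (2 * k + 1)" by simp
          then show ?thesis by (simp only: powr_add[symmetric] pw[OF elim])
        qed
        then show "real D / sqrt pi * R powr (-1) * (?a k * R powr (- 2 * real k)) = real D / sqrt pi * ?a k / R ^ (2 * k + 1)"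
          by (simp add: divide_inverse mult_ac)
      qed simp
      have rhs: "R powr (- (2 * real N + 3)) = 1 / R ^ (2 * N + 3)"
        using pw[OF elim, of "2 * N + 3"] by simp
      show ?case
        unfolding sum rhs real_norm_def using C[OF elim] elim by simp
    qed
  qed
  show ?thesis using class1 lim asym by blast
qed

end
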